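(* Let $\boldsymbol{A}\in\mathbb{R}^{n\times n}$ be invertible with rows $\boldsymbol{a}_1^\top,\dots,\boldsymbol{a}_n^\top$, let $\boldsymbol{b}\in\mathbb{R}^n$, and let $\boldsymbol{x}=\boldsymbol{A}^{-1}\boldsymbol{b}$. Take accelerated randomized Kaczmarz (ARK) with parameters $$\tilde\mu=\frac{\sigma_{\min}^2(\boldsymbol{A})}{\|\boldsymbol{A}\|_{\rm F}^2+n\lambda},\qquad \tilde\nu=\frac{\|\boldsymbol{A}\|_{\rm F}^2+n\lambda}{\min_i\|\boldsymbol{a}_i\|^2+\lambda},$$ where one of the following two options holds: (1) $\lambda=\|\boldsymbol{A}\|_{\rm F}^2/n$; or (2) $\lambda=0$ and $4\min_i\|\boldsymbol{a}_i\|^2\ge\max_i\|\boldsymbol{a}_i\|^2$. Suppose that iterative refinement, executed in floating-point arithmetic with unit roundoff $u$, is performed $t=\log_2\!\left(\frac{1}{\tilde\kappa(\boldsymbol{A})u}\right)$ times (rounded up to an integer), where each refinement (as well as the initial solve) executes a suitable number $\mathcal{O}(\tilde\kappa(\boldsymbol{A})\sqrt n)$ of iterations of ARK. If $\tilde\kappa(\boldsymbol{A})^2u\ll1$, then the computed output $\widehat{\boldsymbol{x}}_t$ of this scheme satisfies $$\mathbb{E}\,\|\widehat{\boldsymbol{x}}_t-\boldsymbol{x}\|\lesssim\|\boldsymbol{x}\|\,\tilde\kappa(\boldsymbol{A})u.$$ (The constant implied by $\mathcal{O}$ is absolute, and the polynomials in $n$ implied by $\ll$ and $\lesssim$ are 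universal.)
   Context: Norms: $\|\cdot\|$ is the vector $\ell_2$ norm and its induced operator norm; $\|\cdot\|_{\rm F}$ is the Frobenius norm; $\sigma_{\min}$ is the smallest singular value. The Demmel condition number is $\tilde\kappa(\boldsymbol{A})=\|\boldsymbol{A}\|_{\rm F}\|\boldsymbol{A}^{-1}\|$. Asymptotic notation: $a\lesssim b$ means $a\le C(n)b$ for a fixed universal (unspecified) polynomial $C(n)>0$; $a\ll b$ means $a\le b/C(n)$ for a sufficiently large universal polynomial $C(n)>0$. ARK for a system $\boldsymbol{A}\boldsymbol{z}=\boldsymbol{c}$ with parameters $\tilde\mu,\tilde\nu>0$, $\lambda\ge0$: set $\beta=1-\sqrt{\tilde\mu/\tilde\nu}$, $\gamma=1/\sqrt{\tilde\mu\tilde\nu}$, $\alpha=1/(1+\gamma\tilde\nu)$. Initialize $\boldsymbol{v}_0=\boldsymbol{y}_0=\boldsymbol{0}$; iteration $k=0,1,2,\dots$ is: $$\boldsymbol{z}_k=\alpha\boldsymbol{v}_k+(1-\alpha)\boldsymbol{y}_k;$$ draw (independently of the past) $r(k)\in\{1,\dots,n\}$ with $\Pr[r(k)=i]=\frac{\|\boldsymbol{a}_i\|^2+\lambda}{\|\boldsymbol{A}\|_{\rm F}^2+n\lambda}$; $$\boldsymbol{w}_k=\frac{\langle\boldsymbol{a}_{r(k)},\boldsymbol{z}_k\rangle-c_{r(k)}}{\|\boldsymbol{a}_{r(k)}\|^2+\lambda}\boldsymbol{a}_{r(k)},\quad \boldsymbol{y}_{k+1}=\boldsymbol{z}_k-\boldsymbol{w}_k,\quad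 \boldsymbol{v}_{k+1}=\beta\boldsymbol{v}_k+(1-\beta)\boldsymbol{z}_k-\gamma\boldsymbol{w}_k.$$ The output after $k$ iterations is $\boldsymbol{z}_k=\alpha\boldsymbol{v}_k+(1-\alpha)\boldsymbol{y}_k$. Iterative refinement: let $\mathrm{Solver}(\boldsymbol{c})$ denote the floating-point output of the prescribed number of ARK iterations on $\boldsymbol{A}\boldsymbol{z}=\boldsymbol{c}$ with fresh independent randomness. The scheme computes $\boldsymbol{x}_0:=\mathrm{Solver}(\boldsymbol{b})$ and $\boldsymbol{x}_{i+1}:=\boldsymbol{x}_i+\mathrm{Solver}(\boldsymbol{b}-\boldsymbol{A}\boldsymbol{x}_i)$ for $i=0,\dots,t-1$, with all operations (including residual computation) in floating-point arithmetic of the same precision $u$. $\widehat{\boldsymbol{x}}_t$ is the computed value of $\boldsymbol{x}_t$. The expectation is over all random row indices. Floating-point model (standard model, unit roundoff $u$, no overflow/underflow): the rounding function $\mathrm{fl}$ satisfies $|\mathrm{fl}(x)-x|\le u|x|$ for all $x\in\mathbb{R}$, and for exactly represented scalars $a,b$ and $\mathrm{op}\in\{+,-,\times,\div\}$ the computed value of $a\,\mathrm{op}\,b$ differs from $a\,\mathrm{op}\,b$ by at most $u\,|a\,\mathrm{op}\,b|$. Vector operations, inner products and matrix–vector products are computed by the standard routines from these scalar operations, and expressions are evaluated in the natural way. The entries of $\boldsymbol{A}$, $\boldsymbol{b}$ and the scalar parameters of the method (including $\alpha,1-\alpha,\beta,1-\beta,\gamma,\lambda$) are exactly represented, and row indices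 are sampled with the stated probabilities. *)

theory Defs
  imports
    "HOL-Probability.Probability_Mass_Function"
    "HOL-Computational_Algebra.Polynomial"
    "Jordan_Normal_Form.Gauss_Jordan_Elimination"
    "Jordan_Normal_Form.Char_Poly"
begin

unbundle no vec_syntax
no_notation inner (infix "\<bullet>" 70)

(* The dimension n is quantified inside the main statement, after the universal constants, so vectors
   and matrices are the carrier-based ones of Jordan_Normal_Form, with row and entry indices 0..<n. *)

section \<open>Norms and condition number\<close>

definition vnorm :: "real vec \<Rightarrow> real" where
  "vnorm v = sqrt (v \<bullet> v)"

definition frob_norm :: "real mat \<Rightarrow> real" where
  "frob_norm A = sqrt (\<Sum>i<dim_row A. \<Sum>j<dim_col A. (A $$ (i, j))\<^sup>2)"

definition op_norm :: "real mat \<Rightarrow> real" where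
  "op_norm A = (SUP v \<in> {v \<in> carrier_vec (dim_col A). vnorm v = 1}. vnorm (A *\<^sub>v v))"

definition singular_values :: "real mat \<Rightarrow> real set" where
  "singular_values A = {s. 0 \<le> s \<and> eigenvalue (transpose_mat A * A) (s\<^sup>2)}"

definition sigma_min :: "real mat \<Rightarrow> real" where
  "sigma_min A = Min (singular_values A)"

(* mat_inverse returns None for singular matrices. *)
definition inv_mat :: "real mat \<Rightarrow> real mat" where
  "inv_mat A = the (mat_inverse A)"

definition demmel_cond :: "real mat \<Rightarrow> real" where
  "demmel_cond A = frob_norm A * op_norm (inv_mat A)"

definition min_row_sq :: "real mat \<Rightarrow> real" where
  "min_row_sq A = Min ((\<lambda>i. (vnorm (row A i))\<^sup>2) ` {..<dim_row A})"

definition max_row_sq :: "real mat \<Rightarrow> real" where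
  "max_row_sq A = Max ((\<lambda>i. (vnorm (row A i))\<^sup>2) ` {..<dim_row A})"

section \<open>Parameters and row sampling of ARK\<close>

definition reg_total :: "real mat \<Rightarrow> real \<Rightarrow> real" where
  "reg_total A lam = (frob_norm A)\<^sup>2 + real (dim_row A) * lam"

definition ark_mu :: "real mat \<Rightarrow> real \<Rightarrow> real" where
  "ark_mu A lam = (sigma_min A)\<^sup>2 / reg_total A lam"

definition ark_nu :: "real mat \<Rightarrow> real \<Rightarrow> real" where
  "ark_nu A lam = reg_total A lam / (min_row_sq A + lam)"

definition ark_beta :: "real \<Rightarrow> real \<Rightarrow> real" where
  "ark_beta mu nu = 1 - sqrt (mu / nu)"

definition ark_gamma :: "real \<Rightarrow> real \<Rightarrow> real" where
  "ark_gamma mu nu = 1 / sqrt (mu * nu)"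

definition ark_alpha :: "real \<Rightarrow> real \<Rightarrow> real" where
  "ark_alpha mu nu = 1 / (1 + ark_gamma mu nu * nu)"

definition row_prob :: "real mat \<Rightarrow> real \<Rightarrow> nat \<Rightarrow> real" where
  "row_prob A lam i =
     (if i < dim_row A then ((vnorm (row A i))\<^sup>2 + lam) / reg_total A lam else 0)"

(* See pmf_row_pmf below. *)
definition row_pmf :: "real mat \<Rightarrow> real \<Rightarrow> nat pmf" where
  "row_pmf A lam = embed_pmf (row_prob A lam)"

section \<open>Floating-point arithmetic\<close>

(* The computed results of the four operations are arbitrary functions of the operands; they need
   not be the rounding of the exact result. *)
record fp_arith =
  rnd :: "real \<Rightarrow> real"
  fadd :: "real \<Rightarrow> real \<Rightarrow> real"
  fsub :: "real \<Rightarrow> real \<Rightarrow> real"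
  fmul :: "real \<Rightarrow> real \<Rightarrow> real"
  fdiv :: "real \<Rightarrow> real \<Rightarrow> real"

definition representable :: "fp_arith \<Rightarrow> real \<Rightarrow> bool" where
  "representable M a \<longleftrightarrow> rnd M a = a"

definition fp_result :: "fp_arith \<Rightarrow> real \<Rightarrow> real \<Rightarrow> real \<Rightarrow> bool" where
  "fp_result M u computed exact \<longleftrightarrow>
     representable M computed \<and> \<bar>computed - exact\<bar> \<le> u * \<bar>exact\<bar>"

definition standard_model :: "fp_arith \<Rightarrow> real \<Rightarrow> bool" where
  "standard_model M u \<longleftrightarrow>
     0 < u \<and>
     (\<forall>a. \<bar>rnd M a - a\<bar> \<le> u * \<bar>a\<bar>) \<and>
     (\<forall>a b. representable M a \<longrightarrow> representable M b \<longrightarrow>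
        fp_result M u (fadd M a b) (a + b) \<and>
        fp_result M u (fsub M a b) (a - b) \<and>
        fp_result M u (fmul M a b) (a * b) \<and>
        (b \<noteq> 0 \<longrightarrow> fp_result M u (fdiv M a b) (a / b)))"

definition fl_vadd :: "fp_arith \<Rightarrow> real vec \<Rightarrow> real vec \<Rightarrow> real vec" where
  "fl_vadd M x y = vec (dim_vec x) (\<lambda>i. fadd M (x $ i) (y $ i))"

definition fl_vsub :: "fp_arith \<Rightarrow> real vec \<Rightarrow> real vec \<Rightarrow> real vec" where
  "fl_vsub M x y = vec (dim_vec x) (\<lambda>i. fsub M (x $ i) (y $ i))"

definition fl_smult :: "fp_arith \<Rightarrow> real \<Rightarrow> real vec \<Rightarrow> real vec" where
  "fl_smult M s x = vec (dim_vec x) (\<lambda>i. fmul M s (x $ i))"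

(* Recursive summation from left to right, started with the first product; meant for nonempty vectors. *)
definition fl_dot :: "fp_arith \<Rightarrow> real vec \<Rightarrow> real vec \<Rightarrow> real" where
  "fl_dot M x y =
     foldl (\<lambda>s i. fadd M s (fmul M (x $ i) (y $ i))) (fmul M (x $ 0) (y $ 0)) [1..<dim_vec x]"

definition fl_matvec :: "fp_arith \<Rightarrow> real mat \<Rightarrow> real vec \<Rightarrow> real vec" where
  "fl_matvec M A x = vec (dim_row A) (\<lambda>i. fl_dot M (row A i) x)"

section \<open>ARK and iterative refinement in floating-point arithmetic\<close>

(* States are the pairs of computed vectors (v, y). *)

definition fl_ark_z :: "fp_arith \<Rightarrow> real \<Rightarrow> real \<Rightarrow> real vec \<times> real vec \<Rightarrow> real vec" where
  "fl_ark_z M mu nu = (\<lambda>(v, y).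
     fl_vadd M (fl_smult M (ark_alpha mu nu) v) (fl_smult M (1 - ark_alpha mu nu) y))"

(* The denominator of the step length is itself computed in floating-point arithmetic. *)
definition fl_ark_step ::
  "fp_arith \<Rightarrow> real mat \<Rightarrow> real vec \<Rightarrow> real \<Rightarrow> real \<Rightarrow> real \<Rightarrow> nat
     \<Rightarrow> real vec \<times> real vec \<Rightarrow> real vec \<times> real vec" where
  "fl_ark_step M A c lam mu nu r = (\<lambda>(v, y).
     let z = fl_ark_z M mu nu (v, y);
         a = row A r;
         w = fl_smult M (fdiv M (fsub M (fl_dot M a z) (c $ r)) (fadd M (fl_dot M a a) lam)) a;
         y' = fl_vsub M z w;
         v' = fl_vsub M
                (fl_vadd M (fl_smult M (ark_beta mu nu) v) (fl_smult M (1 - ark_beta mu nu) z))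
                (fl_smult M (ark_gamma mu nu) w)
     in (v', y'))"

primrec fl_ark_state ::
  "fp_arith \<Rightarrow> real mat \<Rightarrow> real vec \<Rightarrow> real \<Rightarrow> real \<Rightarrow> real \<Rightarrow> nat
     \<Rightarrow> (real vec \<times> real vec) pmf" where
  "fl_ark_state M A c lam mu nu 0 = return_pmf (0\<^sub>v (dim_col A), 0\<^sub>v (dim_col A))"
| "fl_ark_state M A c lam mu nu (Suc k) =
     bind_pmf (fl_ark_state M A c lam mu nu k) (\<lambda>s.
       map_pmf (\<lambda>r. fl_ark_step M A c lam mu nu r s) (row_pmf A lam))"

definition fl_solver ::
  "fp_arith \<Rightarrow> real mat \<Rightarrow> real \<Rightarrow> real \<Rightarrow> real \<Rightarrow> nat \<Rightarrow> real vec \<Rightarrow> real vec pmf" where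
  "fl_solver M A lam mu nu K c = map_pmf (fl_ark_z M mu nu) (fl_ark_state M A c lam mu nu K)"

primrec fl_refine ::
  "fp_arith \<Rightarrow> real mat \<Rightarrow> real \<Rightarrow> real \<Rightarrow> real \<Rightarrow> nat \<Rightarrow> real vec \<Rightarrow> nat \<Rightarrow> real vec pmf" where
  "fl_refine M A lam mu nu K b 0 = fl_solver M A lam mu nu K b"
| "fl_refine M A lam mu nu K b (Suc i) =
     bind_pmf (fl_refine M A lam mu nu K b i) (\<lambda>x.
       map_pmf (\<lambda>d. fl_vadd M x d)
         (fl_solver M A lam mu nu K (fl_vsub M b (fl_matvec M A x))))"

definition data_representable :: "fp_arith \<Rightarrow> real mat \<Rightarrow> real vec \<Rightarrow> bool" where
  "data_representable M A b \<longleftrightarrow>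
     (\<forall>i<dim_row A. \<forall>j<dim_col A. representable M (A $$ (i, j))) \<and>
     (\<forall>i<dim_vec b. representable M (b $ i))"

definition params_representable :: "fp_arith \<Rightarrow> real \<Rightarrow> real \<Rightarrow> real \<Rightarrow> bool" where
  "params_representable M lam mu nu \<longleftrightarrow>
     representable M lam \<and>
     representable M (ark_alpha mu nu) \<and> representable M (1 - ark_alpha mu nu) \<and>
     representable M (ark_beta mu nu) \<and> representable M (1 - ark_beta mu nu) \<and>
     representable M (ark_gamma mu nu)"

section \<open>The sampling distribution is well defined\<close>

lemma sq_vnorm: "(vnorm v)\<^sup>2 = (\<Sum>j<dim_vec v. (v $ j)\<^sup>2)"
proof -
  have "v \<bullet> v = (\<Sum>j<dim_vec v. (v $ j)\<^sup>2)"
    by (simp add: scalar_prod_def power2_eq_square atLeast0LessThan)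
  moreover have "0 \<le> (\<Sum>j<dim_vec v. (v $ j)\<^sup>2)"
    by (simp add: sum_nonneg)
  ultimately show ?thesis by (simp add: vnorm_def)
qed

lemma sum_sq_rows: "(\<Sum>i<dim_row A. (vnorm (row A i))\<^sup>2) = (frob_norm A)\<^sup>2"
proof -
  have "0 \<le> (\<Sum>i<dim_row A. \<Sum>j<dim_col A. (A $$ (i, j))\<^sup>2)"
    by (simp add: sum_nonneg)
  then show ?thesis by (simp add: sq_vnorm frob_norm_def)
qed

lemma pmf_row_pmf:
  assumes "0 \<le> lam" and "0 < reg_total A lam"
  shows "pmf (row_pmf A lam) i = row_prob A lam i"
  unfolding row_pmf_def
proof (rule pmf_embed_pmf)
  show nonneg: "0 \<le> row_prob A lam i" for i
    using assms by (simp add: row_prob_def)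
  have "(\<integral>\<^sup>+i. ennreal (row_prob A lam i) \<partial>count_space UNIV)
      = (\<Sum>i<dim_row A. ennreal (row_prob A lam i))"
    by (rule nn_integral_count_space'[where A = "{..<dim_row A}"]) (auto simp: row_prob_def)
  also have "\<dots> = ennreal (\<Sum>i<dim_row A. row_prob A lam i)"
    by (rule sum_ennreal) (rule nonneg)
  also have "(\<Sum>i<dim_row A. row_prob A lam i)
      = (\<Sum>i<dim_row A. (vnorm (row A i))\<^sup>2 + lam) / reg_total A lam"
    by (simp add: row_prob_def sum_divide_distrib)
  also have "(\<Sum>i<dim_row A. (vnorm (row A i))\<^sup>2 + lam) = reg_total A lam"
    by (simp add: sum.distrib sum_sq_rows reg_total_def)
  finally show "(\<integral>\<^sup>+i. ennreal (row_prob A lam i) \<partial>count_space UNIV) = 1"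
    using assms by simp
qed

end

theory Submission
  imports Defs
begin

text \<open>One run of ARK is only trusted to reduce the error by the factor four in expectation, and
  refinement turns this into full accuracy. The analysis has three layers.

  \<^bold>\<open>Exact arithmetic.\<close> Let \<open>T\<close> be the normalisation of the sampling probabilities, \<open>B\<close> the inverse of
  the transpose of \<open>A\<close> and \<open>rate\<close> the square root of \<open>\<mu> / \<nu>\<close>. Nesterov's Lyapunov function for the
  sampled quadratic is, up to scaling, \<open>\<sigma>^2 |B (v - x)|^2 + |y - x|^2\<close>, and one exact step shrinks it in
  expectation by the factor \<open>1 - rate\<close> (\<open>error_contraction\<close>). The matrix \<open>B\<close> maps the rows of \<open>A\<close> to unit
  vectors, which makes the second moment of the random step explicit. Under either choice of \<open>\<lambda>\<close> the
  rate is at least \<open>1 / (4 \<kappa> sqrt n)\<close>. All this needs that \<open>\<sigma>\<close> is the reciprocal of the operator norm of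
  the inverse (\<open>sigma_min_eq\<close>), so that \<open>\<kappa> = F / \<sigma>\<close>.

  \<^bold>\<open>Rounding errors of a step.\<close> Write \<open>\<epsilon> = n u\<close>. A computed step deviates from the exact step taken from
  the same point by a vector of length \<open>O(\<epsilon> \<kappa> (|x| + U))\<close>, where \<open>U\<close> is the root of the Lyapunov
  function (\<open>fl_ark_step_err\<close>). One factor \<open>\<kappa>\<close> is lost because \<open>\<gamma>\<close> and the distance of \<open>v\<close> from \<open>x\<close> may
  both be as large as \<open>\<kappa>\<close> times the scale of the iterates. The errors accumulate over about \<open>1 / rate\<close> steps,
  which costs another \<open>\<kappa> sqrt n\<close>; so the hypothesis that \<open>\<kappa>^2 u\<close> is small is exactly what is needed for
  the limiting relative error \<open>\<epsilon> \<kappa> / rate\<close> of a run to be below a fixed constant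
  (\<open>fl_step_energy\<close>, \<open>fl_solver_err\<close>).

  \<^bold>\<open>Refinement.\<close> Solving for the computed residual instead of the exact one changes the correction by
  \<open>O(\<epsilon> \<kappa>)\<close> times the size of the current approximation (\<open>fl_residual_err\<close>), with only one factor \<open>\<kappa>\<close>. Hence the
  expected error \<open>E\<close> obeys \<open>E \<mapsto> E / 2 + O(\<epsilon> \<kappa> |x|)\<close>, and \<open>t\<close> halvings bring the first part down to \<open>\<kappa> u |x|\<close>.\<close>

section \<open>The Euclidean norm on carrier vectors\<close>

lemma vnorm_L2: "vnorm v = L2_set (($) v) {..<dim_vec v}"
  by (simp add: vnorm_def L2_set_def scalar_prod_def power2_eq_square atLeast0LessThan)

lemma vnorm_nonneg [simp]: "0 \<le> vnorm v"
  by (simp add: vnorm_L2)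

lemma vnorm_sq: "(vnorm v)\<^sup>2 = v \<bullet> v"
  unfolding sq_vnorm by (simp add: scalar_prod_def power2_eq_square atLeast0LessThan)

lemma vnorm_zero [simp]: "vnorm (0\<^sub>v n) = 0"
  by (simp add: vnorm_def)

lemma vnorm_eq_0_iff: "v \<in> carrier_vec n \<Longrightarrow> vnorm v = 0 \<longleftrightarrow> v = 0\<^sub>v n"
  by (auto simp: vnorm_L2 L2_set_eq_0_iff)

lemma vnorm_smult [simp]: "vnorm (c \<cdot>\<^sub>v v) = \<bar>c\<bar> * vnorm v"
proof -
  have "(vnorm (c \<cdot>\<^sub>v v))\<^sup>2 = (\<bar>c\<bar> * vnorm v)\<^sup>2"
    by (simp add: sq_vnorm power_mult_distrib sum_distrib_left)
  then show ?thesis by (simp add: power2_eq_iff_nonneg)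
qed

lemma vnorm_uminus [simp]: "vnorm (- v) = vnorm v"
  by (simp add: vnorm_def)

lemma vnorm_mono:
  assumes "dim_vec v = dim_vec w" "\<And>i. i < dim_vec w \<Longrightarrow> \<bar>v $ i\<bar> \<le> \<bar>w $ i\<bar>"
  shows "vnorm v \<le> vnorm w"
proof -
  have "(vnorm v)\<^sup>2 \<le> (vnorm w)\<^sup>2"
    unfolding sq_vnorm using assms by (auto intro!: sum_mono simp: abs_le_square_iff)
  then show ?thesis by simp
qed

lemma vnorm_mono_scaled:
  assumes "dim_vec v = dim_vec w" "0 \<le> c"
    and "\<And>i. i < dim_vec w \<Longrightarrow> \<bar>v $ i\<bar> \<le> c * \<bar>w $ i\<bar>"
  shows "vnorm v \<le> c * vnorm w"
proof -
  have "vnorm v \<le> vnorm (c \<cdot>\<^sub>v w)"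
    using assms by (intro vnorm_mono) (auto simp: abs_mult)
  then show ?thesis using assms(2) by simp
qed

lemma vnorm_triangle:
  assumes "dim_vec v = dim_vec w"
  shows "vnorm (v + w) \<le> vnorm v + vnorm w"
proof -
  have "L2_set (($) (v + w)) {..<dim_vec w} = L2_set (\<lambda>i. v $ i + w $ i) {..<dim_vec w}"
    by (rule L2_set_cong) auto
  then show ?thesis
    using L2_set_triangle_ineq[of "($) v" "($) w" "{..<dim_vec w}"] assms by (simp add: vnorm_L2)
qed

lemma vnorm_triangle_minus:
  assumes "dim_vec v = dim_vec w"
  shows "vnorm (v - w) \<le> vnorm v + vnorm w"
proof -
  have "v - w = v + - w" using assms by auto
  then show ?thesis using vnorm_triangle[of v "- w"] assms by simp
qed

lemma vnorm_minus_commute: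
  assumes "dim_vec v = dim_vec w"
  shows "vnorm (v - w) = vnorm (w - v)"
  using assms by (intro antisym vnorm_mono) auto

text \<open>The detour through an intermediate point is how every rounding bound below is assembled.\<close>

lemma vnorm_dist_triangle:
  assumes "x \<in> carrier_vec n" "y \<in> carrier_vec n" "z \<in> carrier_vec n"
  shows "vnorm (x - z) \<le> vnorm (x - y) + vnorm (y - z)"
proof -
  have "x - z = (x - y) + (y - z)" using assms by auto
  then show ?thesis using vnorm_triangle[of "x - y" "y - z"] assms by simp
qed

lemma vnorm_le_add_dist:
  assumes "x \<in> carrier_vec n" "y \<in> carrier_vec n"
  shows "vnorm x \<le> vnorm y + vnorm (x - y)"
proof -
  have "x = y + (x - y)" using assms by auto
  then show ?thesis using vnorm_triangle[of y "x - y"] assms by (metis carrier_vecD index_minus_vec(2))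
qed

lemma abs_sum_le_vnorm:
  assumes "dim_vec w = dim_vec v"
  shows "(\<Sum>i<dim_vec v. \<bar>v $ i\<bar> * \<bar>w $ i\<bar>) \<le> vnorm v * vnorm w"
  using L2_set_mult_ineq[of "($) v" "($) w" "{..<dim_vec v}"] assms by (simp add: vnorm_L2)

lemma scalar_prod_le_vnorm:
  assumes "dim_vec w = dim_vec v"
  shows "\<bar>v \<bullet> w\<bar> \<le> vnorm v * vnorm w"
proof -
  have "\<bar>v \<bullet> w\<bar> \<le> (\<Sum>i<dim_vec v. \<bar>v $ i\<bar> * \<bar>w $ i\<bar>)"
    unfolding scalar_prod_def atLeast0LessThan assms
    by (rule order_trans[OF sum_abs]) (simp add: abs_mult)
  then show ?thesis using abs_sum_le_vnorm[OF assms] by linarith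
qed

lemma vnorm_sq_add_smult:
  fixes c :: real
  assumes "v \<in> carrier_vec n" "w \<in> carrier_vec n"
  shows "(vnorm (v + c \<cdot>\<^sub>v w))\<^sup>2 = (vnorm v)\<^sup>2 + 2 * c * (v \<bullet> w) + c\<^sup>2 * (vnorm w)\<^sup>2"
  unfolding sq_vnorm scalar_prod_def atLeast0LessThan using assms
  by (simp add: power2_eq_square algebra_simps sum.distrib sum_distrib_left)

lemma vnorm_sq_minus_smult:
  fixes c :: real
  assumes "v \<in> carrier_vec n" "w \<in> carrier_vec n"
  shows "(vnorm (v - c \<cdot>\<^sub>v w))\<^sup>2 = (vnorm v)\<^sup>2 - 2 * c * (v \<bullet> w) + c\<^sup>2 * (vnorm w)\<^sup>2"
proof -
  have "v - c \<cdot>\<^sub>v w = v + (- c) \<cdot>\<^sub>v w" using assms by auto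
  then show ?thesis using vnorm_sq_add_smult[OF assms, of "- c"] by simp
qed

lemma vnorm_sq_convex:
  fixes s :: real
  assumes "v \<in> carrier_vec n" "w \<in> carrier_vec n" "0 \<le> s" "s \<le> 1"
  shows "(vnorm ((1 - s) \<cdot>\<^sub>v v + s \<cdot>\<^sub>v w))\<^sup>2 \<le> (1 - s) * (vnorm v)\<^sup>2 + s * (vnorm w)\<^sup>2"
proof -
  have "((1 - s) * a + s * b)\<^sup>2 \<le> (1 - s) * a\<^sup>2 + s * b\<^sup>2" for a b :: real
  proof -
    have "(1 - s) * a\<^sup>2 + s * b\<^sup>2 - ((1 - s) * a + s * b)\<^sup>2 = s * (1 - s) * (a - b)\<^sup>2"
      by (simp add: power2_eq_square algebra_simps)
    then show ?thesis using assms(3,4) by (smt (verit) mult_nonneg_nonneg zero_le_power2)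
  qed
  then have "(\<Sum>i<n. ((1 - s) * v $ i + s * w $ i)\<^sup>2)
      \<le> (\<Sum>i<n. (1 - s) * (v $ i)\<^sup>2 + s * (w $ i)\<^sup>2)"
    by (intro sum_mono) auto
  then show ?thesis
    using assms(1,2) by (simp add: sq_vnorm sum.distrib sum_distrib_left)
qed

section \<open>Matrix norms and the smallest singular value\<close>

lemma frob_norm_nonneg [simp]: "0 \<le> frob_norm A"
  by (simp add: frob_norm_def sum_nonneg)

text \<open>The entrywise hypothesis covers both the exact product and the rounding errors of a computed
  one, whose entries are also bounded by multiples of the row norms.\<close>

lemma vnorm_le_frob_norm:
  assumes "dim_vec w = dim_row A" "0 \<le> c"
    and "\<And>i. i < dim_row A \<Longrightarrow> \<bar>w $ i\<bar> \<le> vnorm (row A i) * c"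
  shows "vnorm w \<le> frob_norm A * c"
proof -
  have "(vnorm w)\<^sup>2 \<le> (\<Sum>i<dim_row A. (vnorm (row A i) * c)\<^sup>2)"
    unfolding sq_vnorm assms(1) using assms(2,3)
    by (intro sum_mono) (metis abs_ge_zero lessThan_iff power2_abs power_mono)
  also have "\<dots> = (frob_norm A * c)\<^sup>2"
    by (simp add: power_mult_distrib sum_sq_rows flip: sum_distrib_right)
  finally show ?thesis
    by (rule power2_le_imp_le) (simp add: assms(2))
qed

lemma vnorm_mult_mat_vec_le_frob:
  assumes "v \<in> carrier_vec (dim_col A)"
  shows "vnorm (A *\<^sub>v v) \<le> frob_norm A * vnorm v"
  using assms by (intro vnorm_le_frob_norm) (auto intro: scalar_prod_le_vnorm)

lemma vnorm_row_le_frob: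
  assumes "i < dim_row A"
  shows "vnorm (row A i) \<le> frob_norm A"
proof -
  have "(vnorm (row A i))\<^sup>2 \<le> (\<Sum>i<dim_row A. (vnorm (row A i))\<^sup>2)"
    using assms by (intro member_le_sum) auto
  then show ?thesis by (simp add: sum_sq_rows)
qed

lemma vnorm_mult_mat_vec_le_op:
  assumes "v \<in> carrier_vec (dim_col A)"
  shows "vnorm (A *\<^sub>v v) \<le> op_norm A * vnorm v"
proof (cases "vnorm v = 0")
  case True
  then have "v = 0\<^sub>v (dim_col A)" using vnorm_eq_0_iff assms by blast
  then have "vnorm (A *\<^sub>v v) \<le> 0"
    using vnorm_mult_mat_vec_le_frob[OF assms] True by simp
  then show ?thesis using True by simp
next
  case False
  then have pos: "0 < vnorm v" by (simp add: less_le)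
  let ?S = "{v \<in> carrier_vec (dim_col A). vnorm v = 1}"
  define w where "w = (1 / vnorm v) \<cdot>\<^sub>v v"
  have w: "w \<in> ?S" using assms pos by (simp add: w_def)
  have "bdd_above ((\<lambda>v. vnorm (A *\<^sub>v v)) ` ?S)"
    by (rule bdd_aboveI[of _ "frob_norm A"]) (use vnorm_mult_mat_vec_le_frob in force)
  then have le: "vnorm (A *\<^sub>v w) \<le> op_norm A"
    unfolding op_norm_def using w by (rule cSUP_upper2[where x = w]) auto
  have "A *\<^sub>v w = (1 / vnorm v) \<cdot>\<^sub>v (A *\<^sub>v v)"
    unfolding w_def using assms by (intro mult_mat_vec[of _ "dim_row A" "dim_col A"]) auto
  then have "vnorm (A *\<^sub>v w) = vnorm (A *\<^sub>v v) / vnorm v"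
    using pos by simp
  with le pos show ?thesis by (simp add: divide_le_eq)
qed

lemma op_norm_le:
  assumes "0 < dim_col A"
    and "\<And>v. v \<in> carrier_vec (dim_col A) \<Longrightarrow> vnorm (A *\<^sub>v v) \<le> c * vnorm v"
  shows "op_norm A \<le> c"
  unfolding op_norm_def
proof (rule cSUP_least)
  have "vnorm (unit_vec (dim_col A) 0) = 1"
    using assms(1) by (simp add: vnorm_def)
  then show "{v \<in> carrier_vec (dim_col A). vnorm v = 1} \<noteq> {}"
    by (metis (mono_tags, lifting) empty_iff mem_Collect_eq unit_vec_carrier)
next
  fix v assume "v \<in> {v \<in> carrier_vec (dim_col A). vnorm v = 1}"
  then show "vnorm (A *\<^sub>v v) \<le> c" using assms(2)[of v] by simp
qed

lemma inv_mat_inverse: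
  assumes A: "A \<in> carrier_mat n n" and inv: "invertible_mat A"
  shows "inv_mat A \<in> carrier_mat n n" "A * inv_mat A = 1\<^sub>m n" "inv_mat A * A = 1\<^sub>m n"
proof -
  obtain B where B: "A * B = 1\<^sub>m n" "B * A = 1\<^sub>m (dim_row B)"
    using inv A unfolding invertible_mat_def inverts_mat_def by auto
  have "dim_row B = n" "dim_col B = n"
    using arg_cong[OF B(2), of dim_col] arg_cong[OF B(1), of dim_col] A by auto
  then have Bc: "B \<in> carrier_mat n n" by auto
  have "mat_inverse A \<noteq> None"
  proof
    assume "mat_inverse A = None"
    then have "A \<notin> Units (ring_mat TYPE(real) n ())"
      using mat_inverse(1)[OF A, where b = "()"] by blast
    then show False
      using A Bc B by (auto simp: Units_def ring_mat_def)
  qed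
  then obtain N where "mat_inverse A = Some N" by blast
  then show "inv_mat A \<in> carrier_mat n n" "A * inv_mat A = 1\<^sub>m n" "inv_mat A * A = 1\<^sub>m n"
    using mat_inverse(2)[OF A] by (auto simp: inv_mat_def)
qed

lemma finite_singular_values:
  assumes A: "A \<in> carrier_mat n n"
  shows "finite (singular_values A)"
proof -
  let ?G = "transpose_mat A * A"
  have G: "?G \<in> carrier_mat n n" using A by simp
  have "char_poly ?G \<noteq> 0" using degree_monic_char_poly[OF G] by auto
  then have "finite {k. poly (char_poly ?G) k = 0}" by (rule poly_roots_finite)
  then have fin: "finite (Collect (eigenvalue ?G))"
    by (simp add: Collect_cong[OF eigenvalue_root_char_poly[OF G]])
  have "singular_values A \<subseteq> sqrt ` Collect (eigenvalue ?G)"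
  proof
    fix s assume "s \<in> singular_values A"
    then have "s = sqrt (s\<^sup>2)" "s\<^sup>2 \<in> Collect (eigenvalue ?G)"
      by (auto simp: singular_values_def)
    then show "s \<in> sqrt ` Collect (eigenvalue ?G)" by blast
  qed
  then show ?thesis using fin finite_subset by blast
qed

text \<open>For a positive semidefinite symmetric \<open>G\<close> with \<open>w \<bullet> G w \<le> L |w|^2\<close>, evaluating the form at
  the gradient step \<open>v - G v / L\<close> gives \<open>|G v|^2 \<le> L (v \<bullet> G v)\<close>. So once \<open>G\<close> is
  invertible, its form is bounded below by a positive multiple of \<open>|v|^2\<close>. This replaces the usual
  compactness argument for the attainment of the least eigenvalue.\<close>

lemma psd_form_coercive:
  assumes G: "G \<in> carrier_mat n n" and sym: "transpose_mat G = G"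
    and psd: "\<And>w. w \<in> carrier_vec n \<Longrightarrow> 0 \<le> w \<bullet> (G *\<^sub>v w)"
    and bound: "\<And>w. w \<in> carrier_vec n \<Longrightarrow> w \<bullet> (G *\<^sub>v w) \<le> L * (vnorm w)\<^sup>2"
    and L: "0 < L"
    and kernel: "\<And>w. w \<in> carrier_vec n \<Longrightarrow> w \<noteq> 0\<^sub>v n \<Longrightarrow> G *\<^sub>v w \<noteq> 0\<^sub>v n"
  obtains c where "0 < c" "\<And>v. v \<in> carrier_vec n \<Longrightarrow> c * (vnorm v)\<^sup>2 \<le> v \<bullet> (G *\<^sub>v v)"
proof -
  have "det G \<noteq> 0" using det_0_iff_vec_prod_zero_field[OF G] kernel by blast
  then have "G \<in> Units (ring_mat TYPE(real) n ())" by (rule det_non_zero_imp_unit[OF G])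
  then obtain N where N: "N \<in> carrier_mat n n" "N * G = 1\<^sub>m n"
    unfolding Units_def ring_mat_def by auto
  define c where "c = 1 / (L * ((frob_norm N)\<^sup>2 + 1))"
  have pos: "0 < L * ((frob_norm N)\<^sup>2 + 1)"
    using L by (intro mult_pos_pos) (auto intro: add_nonneg_pos)
  have "c * (vnorm v)\<^sup>2 \<le> v \<bullet> (G *\<^sub>v v)" if v: "v \<in> carrier_vec n" for v
  proof -
    define g where "g = G *\<^sub>v v"
    have g: "g \<in> carrier_vec n" using G v by (simp add: g_def)
    have vGg: "v \<bullet> (G *\<^sub>v g) = g \<bullet> g"
      using transpose_vec_mult_scalar[OF G g v] sym by (simp add: g_def)
    have "0 \<le> (v - (1 / L) \<cdot>\<^sub>v g) \<bullet> (G *\<^sub>v (v - (1 / L) \<cdot>\<^sub>v g))"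
      using v g by (intro psd) simp
    also have "G *\<^sub>v (v - (1 / L) \<cdot>\<^sub>v g) = g - (1 / L) \<cdot>\<^sub>v (G *\<^sub>v g)"
      using mult_minus_distrib_mat_vec[OF G v, of "(1 / L) \<cdot>\<^sub>v g"] mult_mat_vec[OF G g, of "1 / L"] g
      by (simp flip: g_def)
    also have "(v - (1 / L) \<cdot>\<^sub>v g) \<bullet> \<dots>
        = v \<bullet> g - (2 / L) * (g \<bullet> g) + (1 / L)\<^sup>2 * (g \<bullet> (G *\<^sub>v g))"
      using v g G vGg
      by (simp add: minus_scalar_prod_distrib[of _ n] scalar_prod_minus_distrib[of _ n]
          power2_eq_square algebra_simps)
    also have "\<dots> \<le> v \<bullet> g - (2 / L) * (g \<bullet> g) + (1 / L)\<^sup>2 * (L * (g \<bullet> g))"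
      using mult_left_mono[OF bound[OF g], of "(1 / L)\<^sup>2"] by (simp add: vnorm_sq)
    also have "\<dots> = v \<bullet> g - (g \<bullet> g) / L"
      using L by (simp add: power2_eq_square field_simps)
    finally have 1: "(vnorm g)\<^sup>2 \<le> L * (v \<bullet> g)"
      using L by (simp add: vnorm_sq field_simps)
    have "v = N *\<^sub>v g"
      using assoc_mult_mat_vec[OF N(1) G v] v N(2) by (simp add: g_def)
    then have "vnorm v \<le> frob_norm N * vnorm g"
      using vnorm_mult_mat_vec_le_frob[of g N] N(1) g by simp
    then have "(vnorm v)\<^sup>2 \<le> (frob_norm N)\<^sup>2 * (vnorm g)\<^sup>2"
      by (metis power_mono power_mult_distrib vnorm_nonneg)
    also have "\<dots> \<le> ((frob_norm N)\<^sup>2 + 1) * (vnorm g)\<^sup>2"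
      by (intro mult_right_mono) auto
    also have "\<dots> \<le> ((frob_norm N)\<^sup>2 + 1) * (L * (v \<bullet> g))"
      by (intro mult_left_mono 1) simp
    finally show ?thesis
      using pos by (simp add: c_def g_def divide_le_eq mult_ac)
  qed
  moreover have "0 < c" using pos by (simp add: c_def)
  ultimately show thesis using that by blast
qed

lemma vnorm_mult_inv_ge:
  assumes A: "A \<in> carrier_mat n n" and inv: "invertible_mat A" and v: "v \<in> carrier_vec n"
  shows "vnorm v \<le> op_norm (inv_mat A) * vnorm (A *\<^sub>v v)"
proof -
  note I = inv_mat_inverse[OF A inv]
  have "v = inv_mat A *\<^sub>v (A *\<^sub>v v)"
    using assoc_mult_mat_vec[OF I(1) A v] I(3) v by simp
  then show ?thesis
    using vnorm_mult_mat_vec_le_op[of "A *\<^sub>v v" "inv_mat A"] I(1) A v by simp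
qed

lemma op_norm_inv_pos:
  assumes A: "A \<in> carrier_mat n n" and inv: "invertible_mat A" and n: "1 \<le> n"
  shows "0 < op_norm (inv_mat A)"
proof -
  have "1 \<le> op_norm (inv_mat A) * vnorm (A *\<^sub>v unit_vec n 0)"
    using vnorm_mult_inv_ge[OF A inv, of "unit_vec n 0"] n by (simp add: vnorm_def)
  then show ?thesis
    by (smt (verit) mult_nonneg_nonneg mult_nonpos_nonneg vnorm_nonneg)
qed

text \<open>The reciprocal \<open>\<tau>\<close> of the norm of the inverse is the infimum of \<open>|A v| / |v|\<close>. If \<open>\<tau>^2\<close> were
  not an eigenvalue of the Gram matrix, the form \<open>|A v|^2 - \<tau>^2 |v|^2\<close> would be coercive and the
  infimum would be larger than \<open>\<tau>\<close>.\<close>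

lemma inverse_op_norm_inv_singular_value:
  assumes A: "A \<in> carrier_mat n n" and inv: "invertible_mat A" and n: "1 \<le> n"
  shows "1 / op_norm (inv_mat A) \<in> singular_values A"
proof (rule ccontr)
  define \<tau> where "\<tau> = 1 / op_norm (inv_mat A)"
  assume "1 / op_norm (inv_mat A) \<notin> singular_values A"
  moreover have pos: "0 < \<tau>"
    using op_norm_inv_pos[OF A inv n] by (simp add: \<tau>_def)
  ultimately have no_ev: "\<not> eigenvalue (transpose_mat A * A) (\<tau>\<^sup>2)"
    by (simp add: singular_values_def \<tau>_def)
  note I = inv_mat_inverse[OF A inv]
  define G where "G = transpose_mat A * A - \<tau>\<^sup>2 \<cdot>\<^sub>m 1\<^sub>m n"
  have G: "G \<in> carrier_mat n n" using A by (auto simp: G_def intro!: minus_carrier_mat)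
  have sym: "transpose_mat G = G"
    unfolding G_def using A by (intro eq_matI) (auto intro!: comm_scalar_prod[of _ n])
  have Gv: "G *\<^sub>v v = transpose_mat A *\<^sub>v (A *\<^sub>v v) - \<tau>\<^sup>2 \<cdot>\<^sub>v v" if v: "v \<in> carrier_vec n" for v
  proof -
    have "(\<tau>\<^sup>2 \<cdot>\<^sub>m 1\<^sub>m n) *\<^sub>v v = \<tau>\<^sup>2 \<cdot>\<^sub>v v"
      using v by (intro eq_vecI) auto
    then show ?thesis
      unfolding G_def using v A by (subst minus_mult_distrib_mat_vec[of _ n n]) auto
  qed
  have form: "v \<bullet> (G *\<^sub>v v) = (vnorm (A *\<^sub>v v))\<^sup>2 - \<tau>\<^sup>2 * (vnorm v)\<^sup>2"
    if v: "v \<in> carrier_vec n" for v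
  proof -
    have Av: "A *\<^sub>v v \<in> carrier_vec n" using A v by simp
    have At: "transpose_mat A \<in> carrier_mat n n" using A by simp
    have "v \<bullet> (transpose_mat A *\<^sub>v (A *\<^sub>v v)) = (A *\<^sub>v v) \<bullet> (A *\<^sub>v v)"
      using transpose_vec_mult_scalar[OF At Av v] by simp
    then show ?thesis
      unfolding Gv[OF v] vnorm_sq using v At Av
      by (subst scalar_prod_minus_distrib[of _ n]) auto
  qed
  have low: "\<tau> * vnorm v \<le> vnorm (A *\<^sub>v v)" if "v \<in> carrier_vec n" for v
    using vnorm_mult_inv_ge[OF A inv that] pos op_norm_inv_pos[OF A inv n]
    by (simp add: \<tau>_def field_simps)
  have psd: "0 \<le> v \<bullet> (G *\<^sub>v v)" if v: "v \<in> carrier_vec n" for v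
  proof -
    have "(\<tau> * vnorm v)\<^sup>2 \<le> (vnorm (A *\<^sub>v v))\<^sup>2"
      using low[OF v] pos by (intro power_mono) auto
    then show ?thesis using form[OF v] by (simp add: power_mult_distrib)
  qed
  have bound: "v \<bullet> (G *\<^sub>v v) \<le> ((frob_norm A)\<^sup>2 + 1) * (vnorm v)\<^sup>2" if v: "v \<in> carrier_vec n" for v
  proof -
    have "(vnorm (A *\<^sub>v v))\<^sup>2 \<le> (frob_norm A * vnorm v)\<^sup>2"
      using vnorm_mult_mat_vec_le_frob[of v A] A v by (intro power_mono) auto
    moreover have "0 \<le> \<tau>\<^sup>2 * (vnorm v)\<^sup>2" "0 \<le> (vnorm v)\<^sup>2" by simp_all
    ultimately show ?thesis
      unfolding form[OF v] power_mult_distrib distrib_right by linarith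
  qed
  have kernel: "G *\<^sub>v v \<noteq> 0\<^sub>v n" if v: "v \<in> carrier_vec n" and nz: "v \<noteq> 0\<^sub>v n" for v
  proof
    let ?g = "transpose_mat A *\<^sub>v (A *\<^sub>v v)"
    assume "G *\<^sub>v v = 0\<^sub>v n"
    then have z: "?g - \<tau>\<^sup>2 \<cdot>\<^sub>v v = 0\<^sub>v n" using Gv[OF v] by simp
    have gc: "?g \<in> carrier_vec n" using A v by simp
    have "?g = \<tau>\<^sup>2 \<cdot>\<^sub>v v"
    proof (rule eq_vecI)
      fix i assume "i < dim_vec (\<tau>\<^sup>2 \<cdot>\<^sub>v v)"
      then have "i < n" using v by simp
      then show "?g $ i = (\<tau>\<^sup>2 \<cdot>\<^sub>v v) $ i"
        using arg_cong[OF z, of "\<lambda>w. w $ i"] v gc by simp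
    qed (use gc v A in simp)
    moreover have "(transpose_mat A * A) *\<^sub>v v = ?g"
      using A v by (intro assoc_mult_mat_vec[of _ n n _ n]) auto
    ultimately have "eigenvector (transpose_mat A * A) v (\<tau>\<^sup>2)"
      using A v nz by (simp add: eigenvector_def)
    then show False using no_ev by (auto simp: eigenvalue_def)
  qed
  obtain c where c: "0 < c" "\<And>v. v \<in> carrier_vec n \<Longrightarrow> c * (vnorm v)\<^sup>2 \<le> v \<bullet> (G *\<^sub>v v)"
    by (rule psd_form_coercive[OF G sym, of "(frob_norm A)\<^sup>2 + 1"])
      (use psd bound kernel in \<open>auto intro: add_nonneg_pos\<close>)
  define \<tau>' where "\<tau>' = sqrt (\<tau>\<^sup>2 + c)"
  have \<tau>': "\<tau> < \<tau>'" using pos c(1) by (simp add: \<tau>'_def real_less_rsqrt)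
  have "op_norm (inv_mat A) \<le> 1 / \<tau>'"
  proof (rule op_norm_le)
    show "0 < dim_col (inv_mat A)" using I(1) n by simp
  next
    fix w :: "real vec" assume "w \<in> carrier_vec (dim_col (inv_mat A))"
    then have w: "w \<in> carrier_vec n" using I(1) by simp
    define v where "v = inv_mat A *\<^sub>v w"
    have v: "v \<in> carrier_vec n" using I(1) w by (simp add: v_def)
    have "A *\<^sub>v v = w"
      using assoc_mult_mat_vec[OF A I(1) w] I(2) w by (simp add: v_def)
    then have "\<tau>'\<^sup>2 * (vnorm v)\<^sup>2 \<le> (vnorm w)\<^sup>2"
      using c(2)[OF v] form[OF v] c(1) by (simp add: \<tau>'_def algebra_simps)
    then have "(\<tau>' * vnorm v)\<^sup>2 \<le> (vnorm w)\<^sup>2" by (simp add: power_mult_distrib)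
    then have "\<tau>' * vnorm v \<le> vnorm w" by (rule power2_le_imp_le) simp
    then show "vnorm (inv_mat A *\<^sub>v w) \<le> 1 / \<tau>' * vnorm w"
      using \<tau>' pos by (simp add: v_def field_simps)
  qed
  also have "\<dots> < 1 / \<tau>" using \<tau>' pos by (simp add: frac_less2)
  finally show False by (simp add: \<tau>_def)
qed

lemma sigma_min_eq:
  assumes A: "A \<in> carrier_mat n n" and inv: "invertible_mat A" and n: "1 \<le> n"
  shows "sigma_min A = 1 / op_norm (inv_mat A)"
  unfolding sigma_min_def
proof (rule Min_eqI[OF finite_singular_values[OF A] _ inverse_op_norm_inv_singular_value[OF A inv n]])
  fix s assume "s \<in> singular_values A"
  then obtain v where s: "0 \<le> s" and ev: "eigenvector (transpose_mat A * A) v (s\<^sup>2)"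
    by (auto simp: singular_values_def eigenvalue_def)
  have v: "v \<in> carrier_vec n" "v \<noteq> 0\<^sub>v n" and eq: "(transpose_mat A * A) *\<^sub>v v = s\<^sup>2 \<cdot>\<^sub>v v"
    using ev A by (auto simp: eigenvector_def)
  have Av: "A *\<^sub>v v \<in> carrier_vec n" and At: "transpose_mat A \<in> carrier_mat n n"
    using A v by auto
  have "(A *\<^sub>v v) \<bullet> (A *\<^sub>v v) = v \<bullet> (transpose_mat A *\<^sub>v (A *\<^sub>v v))"
    using transpose_vec_mult_scalar[OF At Av v(1)] by simp
  also have "transpose_mat A *\<^sub>v (A *\<^sub>v v) = s\<^sup>2 \<cdot>\<^sub>v v"
    using assoc_mult_mat_vec[OF At A v(1)] eq by simp
  finally have "(vnorm (A *\<^sub>v v))\<^sup>2 = (s * vnorm v)\<^sup>2"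
    using v by (simp add: vnorm_sq power_mult_distrib)
  then have "vnorm (A *\<^sub>v v) = s * vnorm v"
    using s by (simp add: power2_eq_iff_nonneg)
  moreover have "0 < vnorm v" using vnorm_eq_0_iff[OF v(1)] v(2) by (simp add: less_le)
  ultimately show "1 / op_norm (inv_mat A) \<le> s"
    using vnorm_mult_inv_ge[OF A inv v(1)] op_norm_inv_pos[OF A inv n]
    by (simp add: field_simps)
qed

section \<open>Contraction of ARK in exact arithmetic\<close>

locale ark_system =
  fixes n :: nat and A :: "real mat" and lam :: real
  assumes dim_pos: "1 \<le> n"
    and A_carrier: "A \<in> carrier_mat n n"
    and A_invertible: "invertible_mat A"
    and lam_choice: "lam = (frob_norm A)\<^sup>2 / real n \<or> (lam = 0 \<and> max_row_sq A \<le> 4 * min_row_sq A)"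
begin

abbreviation "\<sigma> \<equiv> sigma_min A"
abbreviation "\<kappa> \<equiv> demmel_cond A"
abbreviation "F \<equiv> frob_norm A"
abbreviation "T \<equiv> reg_total A lam"
abbreviation "\<mu> \<equiv> ark_mu A lam"
abbreviation "\<nu> \<equiv> ark_nu A lam"
abbreviation "\<alpha> \<equiv> ark_alpha \<mu> \<nu>"
abbreviation "\<beta> \<equiv> ark_beta \<mu> \<nu>"
abbreviation "\<gamma> \<equiv> ark_gamma \<mu> \<nu>"

definition m where "m = min_row_sq A + lam"

definition rate where "rate = sqrt (\<mu> / \<nu>)"

definition denom where "denom r = (vnorm (row A r))\<^sup>2 + lam"

lemma dims [simp]: "dim_row A = n" "dim_col A = n"
  using A_carrier by auto

lemma row_A_carrier [simp]: "row A r \<in> carrier_vec n"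
  by (rule carrier_vecI) simp

lemma inv_carrier [simp]: "inv_mat A \<in> carrier_mat n n"
  and A_inv: "A * inv_mat A = 1\<^sub>m n" and inv_A: "inv_mat A * A = 1\<^sub>m n"
  using inv_mat_inverse[OF A_carrier A_invertible] by auto

lemma inv_dims [simp]: "dim_row (inv_mat A) = n" "dim_col (inv_mat A) = n"
  using inv_carrier by (auto simp del: inv_carrier)

lemma mult_A_carrier [simp]: "v \<in> carrier_vec n \<Longrightarrow> A *\<^sub>v v \<in> carrier_vec n"
  using A_carrier by (rule mult_mat_vec_carrier)

lemma mult_inv_carrier [simp]: "v \<in> carrier_vec n \<Longrightarrow> inv_mat A *\<^sub>v v \<in> carrier_vec n"
  by (rule mult_mat_vec_carrier[OF inv_carrier])

lemma inv_A_vec: "v \<in> carrier_vec n \<Longrightarrow> inv_mat A *\<^sub>v (A *\<^sub>v v) = v"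
  using assoc_mult_mat_vec[OF inv_carrier A_carrier, of v] by (simp add: inv_A)

lemma A_inv_vec: "v \<in> carrier_vec n \<Longrightarrow> A *\<^sub>v (inv_mat A *\<^sub>v v) = v"
  using assoc_mult_mat_vec[OF A_carrier inv_carrier, of v] by (simp add: A_inv)

lemma sigma_pos: "0 < \<sigma>"
  using sigma_min_eq[OF A_carrier A_invertible dim_pos] op_norm_inv_pos[OF A_carrier A_invertible dim_pos]
  by simp

lemma kappa_eq: "\<kappa> = F / \<sigma>"
  by (simp add: demmel_cond_def sigma_min_eq[OF A_carrier A_invertible dim_pos])

lemma sigma_mult_le: "v \<in> carrier_vec n \<Longrightarrow> \<sigma> * vnorm v \<le> vnorm (A *\<^sub>v v)"
  using vnorm_mult_inv_ge[OF A_carrier A_invertible, of v] op_norm_inv_pos[OF A_carrier A_invertible dim_pos]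
  by (simp add: sigma_min_eq[OF A_carrier A_invertible dim_pos] field_simps)

lemma inv_mult_le: "v \<in> carrier_vec n \<Longrightarrow> \<sigma> * vnorm (inv_mat A *\<^sub>v v) \<le> vnorm v"
  using sigma_mult_le[of "inv_mat A *\<^sub>v v"] by (simp add: A_inv_vec)

lemma sigma_le_F: "\<sigma> \<le> F"
proof -
  have 1: "vnorm (unit_vec n 0) = 1" using dim_pos by (simp add: vnorm_def)
  show ?thesis
    using sigma_mult_le[of "unit_vec n 0"] vnorm_mult_mat_vec_le_frob[of "unit_vec n 0" A] 1 by simp
qed

lemma F_pos: "0 < F"
  using sigma_pos sigma_le_F by simp

lemma kappa_ge_1: "1 \<le> \<kappa>"
  using sigma_pos sigma_le_F by (simp add: kappa_eq)

lemma min_row_sq_le: "r < n \<Longrightarrow> min_row_sq A \<le> (vnorm (row A r))\<^sup>2"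
  unfolding min_row_sq_def by (rule Min_le) auto

lemma min_row_sq_nonneg: "0 \<le> min_row_sq A"
  unfolding min_row_sq_def using dim_pos by (subst Min_ge_iff) (auto simp: lessThan_empty_iff)

lemma le_max_row_sq: "r < n \<Longrightarrow> (vnorm (row A r))\<^sup>2 \<le> max_row_sq A"
  unfolding max_row_sq_def by (rule Max_ge) auto

lemma lam_nonneg: "0 \<le> lam"
  using lam_choice by auto

lemma T_ge: "F\<^sup>2 \<le> T"
  using lam_nonneg by (simp add: reg_total_def)

lemma T_le: "T \<le> 2 * F\<^sup>2"
  using lam_choice dim_pos by (auto simp: reg_total_def)

lemma T_pos: "0 < T"
  using less_le_trans[OF zero_less_power[OF F_pos] T_ge] .

lemma m_le_denom: "r < n \<Longrightarrow> m \<le> denom r"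
  using min_row_sq_le by (simp add: m_def denom_def)

lemma m_le_T: "m \<le> T"
proof -
  have "min_row_sq A \<le> F\<^sup>2"
    using order_trans[OF min_row_sq_le[of 0] power_mono[OF vnorm_row_le_frob[of 0 A] vnorm_nonneg]]
      dim_pos by simp
  moreover have "lam \<le> real n * lam"
    using lam_nonneg dim_pos mult_right_mono[of 1 "real n" lam] by simp
  ultimately show ?thesis by (simp add: m_def reg_total_def)
qed

text \<open>Either choice of \<open>\<lambda>\<close> keeps the regularised row norms balanced: no row is sampled with less than a
  constant fraction of the uniform probability.\<close>

lemma m_ge: "F\<^sup>2 \<le> 4 * real n * m"
  using lam_choice
proof
  assume "lam = F\<^sup>2 / real n"
  then have "F\<^sup>2 = real n * lam" using dim_pos by simp
  also have "\<dots> \<le> real n * m"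
    using min_row_sq_nonneg by (intro mult_left_mono) (auto simp: m_def)
  also have "\<dots> \<le> 4 * real n * m"
    using min_row_sq_nonneg lam_nonneg by (simp add: m_def)
  finally show ?thesis .
next
  assume asm: "lam = 0 \<and> max_row_sq A \<le> 4 * min_row_sq A"
  have "F\<^sup>2 = (\<Sum>r<n. (vnorm (row A r))\<^sup>2)" using sum_sq_rows[of A] by simp
  also have "\<dots> \<le> (\<Sum>r<n. 4 * m)"
    unfolding m_def using order_trans[OF le_max_row_sq] asm by (intro sum_mono) simp
  finally show ?thesis by simp
qed

lemma m_pos: "0 < m"
proof -
  have "0 < 4 * real n * m" using less_le_trans[OF zero_less_power[OF F_pos] m_ge] .
  then show ?thesis using dim_pos by (simp add: zero_less_mult_iff)
qed

lemma denom_pos: "r < n \<Longrightarrow> 0 < denom r"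
  using m_le_denom m_pos by fastforce

lemma mu_eq: "\<mu> = \<sigma>\<^sup>2 / T" and nu_eq: "\<nu> = T / m"
  by (simp_all add: ark_mu_def ark_nu_def m_def)

lemma rate_eq: "rate = \<sigma> * sqrt m / T"
  using T_pos sigma_pos
  by (simp add: rate_def mu_eq nu_eq real_sqrt_divide real_sqrt_mult)

lemma gamma_eq: "\<gamma> = sqrt m / \<sigma>"
  using T_pos sigma_pos by (simp add: ark_gamma_def mu_eq nu_eq real_sqrt_divide)

lemma beta_eq: "\<beta> = 1 - rate"
  by (simp add: ark_beta_def rate_def)

lemma rate_pos: "0 < rate"
  using T_pos sigma_pos m_pos by (simp add: rate_eq)

lemma alpha_eq: "\<alpha> = rate / (1 + rate)"
proof -
  have "\<gamma> * \<nu> = 1 / rate"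
    unfolding gamma_eq unfolding nu_eq rate_eq using T_pos sigma_pos m_pos by (simp add: field_simps)
  then show ?thesis
    unfolding ark_alpha_def using rate_pos by (simp only:) (simp add: field_simps)
qed

lemma sqrt_m_F_le_T: "F * sqrt m \<le> T"
proof -
  have "(F * sqrt m)\<^sup>2 \<le> T\<^sup>2"
    unfolding power_mult_distrib real_sqrt_pow2[OF less_imp_le[OF m_pos]] power2_eq_square[of T]
    using T_ge m_le_T m_pos T_pos by (intro mult_mono) simp_all
  then show ?thesis
    using T_pos by (rule power2_le_imp_le[OF _ less_imp_le])
qed

lemma kappa_rate_le: "\<kappa> * rate \<le> 1"
  using sqrt_m_F_le_T T_pos sigma_pos by (simp add: kappa_eq rate_eq)

lemma rate_le_1: "rate \<le> 1"
  using kappa_rate_le mult_right_mono[OF kappa_ge_1 less_imp_le[OF rate_pos]] by simp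

lemma rate_ge: "1 \<le> 4 * \<kappa> * sqrt (real n) * rate"
proof -
  have "F \<le> 2 * sqrt (real n) * sqrt m"
    by (rule power2_le_imp_le) (use m_ge m_pos in \<open>simp_all add: power_mult_distrib\<close>)
  then have "F * F \<le> 2 * sqrt (real n) * sqrt m * F"
    by (intro mult_right_mono) auto
  then have "T \<le> 4 * sqrt (real n) * sqrt m * F"
    using T_le by (simp add: power2_eq_square)
  then show ?thesis
    using T_pos sigma_pos by (simp add: kappa_eq rate_eq field_simps)
qed

lemma gamma_nonneg: "0 \<le> \<gamma>"
  using sigma_pos m_pos by (simp add: gamma_eq)

lemma gamma_le: "\<gamma> \<le> 2 * \<kappa>"
proof -
  have "m \<le> (2 * F)\<^sup>2" using m_le_T T_le by (simp add: power_mult_distrib) (use zero_le_power2[of F] in linarith)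
  then have "sqrt m \<le> 2 * F" by (intro real_le_lsqrt) (use m_pos F_pos in auto)
  then show ?thesis
    using sigma_pos by (simp add: gamma_eq kappa_eq divide_right_mono)
qed

lemma alpha_nonneg: "0 \<le> \<alpha>" and alpha_le_rate: "\<alpha> \<le> rate" and alpha_le_1: "\<alpha> \<le> 1"
  using rate_pos by (simp_all add: alpha_eq field_simps)

lemma alpha_kappa_le: "\<alpha> * \<kappa> \<le> 1"
proof -
  have "\<alpha> * \<kappa> \<le> rate * \<kappa>" using alpha_le_rate kappa_ge_1 by (intro mult_right_mono) auto
  then show ?thesis using kappa_rate_le by (simp only: mult.commute)
qed

lemma beta_nonneg: "0 \<le> \<beta>" and beta_le_1: "\<beta> \<le> 1"
  using rate_pos rate_le_1 by (simp_all add: beta_eq)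

lemma row_prob_eq: "r < n \<Longrightarrow> row_prob A lam r = denom r / T"
  by (simp add: row_prob_def denom_def)

lemma sum_denom: "(\<Sum>r<n. denom r) = T"
  using sum_sq_rows[of A] by (simp add: denom_def sum.distrib reg_total_def)

text \<open>The mean update direction is \<open>H (z - x)\<close> with \<open>H = A^T A / T\<close>, and \<open>T |dual v|^2\<close> is the quadratic
  form of the inverse of \<open>H\<close>. In this norm every Kaczmarz direction has the same length, because \<open>dual\<close>
  maps the rows of \<open>A\<close> to the standard basis.\<close>

definition dual where "dual = transpose_mat (inv_mat A)"

lemma dual_carrier [simp]: "dual \<in> carrier_mat n n"
  by (simp add: dual_def)

lemma dual_vec_carrier [simp]: "v \<in> carrier_vec n \<Longrightarrow> dual *\<^sub>v v \<in> carrier_vec n"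
  by (rule mult_mat_vec_carrier[OF dual_carrier])

lemma dual_row: "r < n \<Longrightarrow> dual *\<^sub>v row A r = unit_vec n r"
proof (rule eq_vecI)
  fix i assume r: "r < n" and "i < dim_vec (unit_vec n r :: real vec)"
  then have i: "i < n" by simp
  have "(dual *\<^sub>v row A r) $ i = col (inv_mat A) i \<bullet> row A r"
    using i by (simp add: dual_def)
  also have "\<dots> = row A r \<bullet> col (inv_mat A) i"
    by (intro comm_scalar_prod[of _ n] carrier_vecI) simp_all
  also have "\<dots> = (A * inv_mat A) $$ (r, i)"
    using i r by simp
  finally show "(dual *\<^sub>v row A r) $ i = unit_vec n r $ i"
    using i r by (auto simp: A_inv)
qed (simp add: dual_def)

lemma dual_scalar_prod:
  assumes "v \<in> carrier_vec n" "w \<in> carrier_vec n"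
  shows "(dual *\<^sub>v v) \<bullet> (A *\<^sub>v w) = v \<bullet> w"
  using transpose_vec_mult_scalar[OF inv_carrier, of "A *\<^sub>v w" v] assms
  by (simp add: dual_def inv_A_vec)

lemma sigma_dual_le: assumes v: "v \<in> carrier_vec n" shows "\<sigma> * vnorm (dual *\<^sub>v v) \<le> vnorm v"
proof (cases "vnorm (dual *\<^sub>v v) = 0")
  case False
  let ?d = "dual *\<^sub>v v"
  have "(vnorm ?d)\<^sup>2 = v \<bullet> (inv_mat A *\<^sub>v ?d)"
    using transpose_vec_mult_scalar[OF inv_carrier dual_vec_carrier[OF v] v]
    by (simp add: vnorm_sq dual_def)
  also have "\<dots> \<le> vnorm v * vnorm (inv_mat A *\<^sub>v ?d)"
    using scalar_prod_le_vnorm[of "inv_mat A *\<^sub>v ?d" v] v inv_carrier by fastforce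
  finally have "\<sigma> * (vnorm ?d)\<^sup>2 \<le> \<sigma> * (vnorm v * vnorm (inv_mat A *\<^sub>v ?d))"
    using sigma_pos by (intro mult_left_mono) auto
  also have "\<dots> \<le> vnorm v * vnorm ?d"
    using mult_left_mono[OF inv_mult_le[of ?d], of "vnorm v"] v by (simp add: mult_ac)
  finally have "(\<sigma> * vnorm ?d) * vnorm ?d \<le> vnorm v * vnorm ?d"
    by (simp add: power2_eq_square)
  then show ?thesis
    using False by (metis mult_right_le_imp_le vnorm_nonneg less_le)
qed simp

lemma vnorm_le_dual: assumes v: "v \<in> carrier_vec n" shows "vnorm v \<le> F * vnorm (dual *\<^sub>v v)"
proof (cases "vnorm v = 0")
  case False
  have "vnorm v * vnorm v = (dual *\<^sub>v v) \<bullet> (A *\<^sub>v v)"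
    using dual_scalar_prod[OF v v] by (simp add: vnorm_sq flip: power2_eq_square)
  also have "\<dots> \<le> vnorm (dual *\<^sub>v v) * vnorm (A *\<^sub>v v)"
    using scalar_prod_le_vnorm[of "A *\<^sub>v v" "dual *\<^sub>v v"] dual_carrier by fastforce
  also have "\<dots> \<le> vnorm (dual *\<^sub>v v) * (F * vnorm v)"
    using v by (intro mult_left_mono vnorm_mult_mat_vec_le_frob) auto
  finally have "vnorm v * vnorm v \<le> (F * vnorm (dual *\<^sub>v v)) * vnorm v"
    by (simp add: mult_ac)
  then show ?thesis
    using False by (metis mult_right_le_imp_le vnorm_nonneg less_le)
qed simp

text \<open>Here \<open>p\<close>, \<open>q\<close> and \<open>e\<close> stand for the errors of \<open>v\<close>, \<open>y\<close> and \<open>z\<close>. The quadratic terms of the two squared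
  norms are absorbed row by row by half of the linear term of the second one each, because
  \<open>\<gamma>^2 \<sigma>^2 = m\<close> and the squared row norm are both at most the denominator of the step. What is left of
  the first linear term averages to \<open>2 rate (e \<bullet> g)\<close>, and \<open>\<alpha>\<close> is the weight for which the remaining
  terms in \<open>|e|^2\<close> cancel.\<close>

lemma error_contraction:
  assumes p: "p \<in> carrier_vec n" and q: "q \<in> carrier_vec n"
    and e_def: "e = \<alpha> \<cdot>\<^sub>v p + (1 - \<alpha>) \<cdot>\<^sub>v q"
    and g_def: "g = \<beta> \<cdot>\<^sub>v p + (1 - \<beta>) \<cdot>\<^sub>v e"
  shows "(\<Sum>r<n. row_prob A lam r *
      (\<sigma>\<^sup>2 * (vnorm (dual *\<^sub>v (g - (\<gamma> * ((row A r \<bullet> e) / denom r)) \<cdot>\<^sub>v row A r)))\<^sup>2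
        + (vnorm (e - ((row A r \<bullet> e) / denom r) \<cdot>\<^sub>v row A r))\<^sup>2))
    \<le> (1 - rate) * (\<sigma>\<^sup>2 * (vnorm (dual *\<^sub>v p))\<^sup>2 + (vnorm q)\<^sup>2)"
proof -
  have e: "e \<in> carrier_vec n" and g: "g \<in> carrier_vec n"
    using p q by (simp_all add: e_def g_def)
  define G where "G = dual *\<^sub>v g"
  have G: "G \<in> carrier_vec n" using g by (simp add: G_def)
  have row_bound: "row_prob A lam r *
      (\<sigma>\<^sup>2 * (vnorm (dual *\<^sub>v (g - (\<gamma> * ((row A r \<bullet> e) / denom r)) \<cdot>\<^sub>v row A r)))\<^sup>2
        + (vnorm (e - ((row A r \<bullet> e) / denom r) \<cdot>\<^sub>v row A r))\<^sup>2)
      \<le> denom r * ((\<sigma>\<^sup>2 * (vnorm G)\<^sup>2 + (vnorm e)\<^sup>2) / T) - 2 * rate * ((row A r \<bullet> e) * G $ r)"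
    if r: "r < n" for r
  proof -
    define c where "c = row A r \<bullet> e"
    define d where "d = denom r"
    have d: "0 < d" using denom_pos[OF r] by (simp add: d_def)
    define t where "t = \<gamma> * (c / d)"
    have "dual *\<^sub>v (g - t \<cdot>\<^sub>v row A r) = G - t \<cdot>\<^sub>v unit_vec n r"
      using mult_minus_distrib_mat_vec[OF dual_carrier g, of "t \<cdot>\<^sub>v row A r"]
        mult_mat_vec[OF dual_carrier, of "row A r" t] dual_row[OF r]
      by (simp add: G_def)
    then have 1: "(vnorm (dual *\<^sub>v (g - t \<cdot>\<^sub>v row A r)))\<^sup>2 = (vnorm G)\<^sup>2 - 2 * t * G $ r + t\<^sup>2"
      using vnorm_sq_minus_smult[OF G, of "unit_vec n r" t] r G by (simp add: vnorm_def)
    have 2: "(vnorm (e - (c / d) \<cdot>\<^sub>v row A r))\<^sup>2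
        = (vnorm e)\<^sup>2 - 2 * (c / d) * c + (c / d)\<^sup>2 * (vnorm (row A r))\<^sup>2"
      using vnorm_sq_minus_smult[OF e, of "row A r" "c / d"] comm_scalar_prod[OF e, of "row A r"]
      by (simp add: c_def)
    have gs: "\<gamma>\<^sup>2 * \<sigma>\<^sup>2 = m"
      using sigma_pos m_pos by (simp add: gamma_eq power_divide)
    have "\<sigma>\<^sup>2 * t\<^sup>2 + (c / d)\<^sup>2 * (vnorm (row A r))\<^sup>2 = (c / d)\<^sup>2 * (m + (vnorm (row A r))\<^sup>2)"
      by (simp add: t_def power_mult_distrib power_divide algebra_simps flip: gs)
    also have "\<dots> \<le> (c / d)\<^sup>2 * (d + d)"
      using m_le_denom[OF r] lam_nonneg
      by (intro mult_left_mono add_mono) (auto simp: d_def denom_def)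
    also have "\<dots> = 2 * (c / d) * c"
      using d by (simp add: power2_eq_square)
    finally have "\<sigma>\<^sup>2 * ((vnorm G)\<^sup>2 - 2 * t * G $ r + t\<^sup>2)
        + ((vnorm e)\<^sup>2 - 2 * (c / d) * c + (c / d)\<^sup>2 * (vnorm (row A r))\<^sup>2)
        \<le> (\<sigma>\<^sup>2 * (vnorm G)\<^sup>2 + (vnorm e)\<^sup>2) - \<sigma>\<^sup>2 * (2 * t * G $ r)"
      by (simp add: algebra_simps)
    then have "row_prob A lam r * (\<sigma>\<^sup>2 * ((vnorm G)\<^sup>2 - 2 * t * G $ r + t\<^sup>2)
        + ((vnorm e)\<^sup>2 - 2 * (c / d) * c + (c / d)\<^sup>2 * (vnorm (row A r))\<^sup>2))
      \<le> d / T * ((\<sigma>\<^sup>2 * (vnorm G)\<^sup>2 + (vnorm e)\<^sup>2) - \<sigma>\<^sup>2 * (2 * t * G $ r))"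
      unfolding row_prob_eq[OF r] d_def[symmetric] using d T_pos by (intro mult_left_mono) simp_all
    also have "\<dots> = d * ((\<sigma>\<^sup>2 * (vnorm G)\<^sup>2 + (vnorm e)\<^sup>2) / T) - 2 * rate * (c * G $ r)"
      using d T_pos sigma_pos
      by (simp add: t_def gamma_eq rate_eq power2_eq_square field_simps)
    finally show ?thesis
      unfolding 1[symmetric] 2[symmetric] unfolding t_def unfolding c_def d_def .
  qed
  have "(\<Sum>r<n. (row A r \<bullet> e) * G $ r) = (A *\<^sub>v e) \<bullet> G"
    using G by (simp add: scalar_prod_def atLeast0LessThan)
  also have "\<dots> = g \<bullet> e"
    using dual_scalar_prod[OF g e] comm_scalar_prod[OF mult_A_carrier[OF e] G] by (simp add: G_def)
  finally have sum_cross: "(\<Sum>r<n. (row A r \<bullet> e) * G $ r) = g \<bullet> e" .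
  have "(\<Sum>r<n. denom r * ((\<sigma>\<^sup>2 * (vnorm G)\<^sup>2 + (vnorm e)\<^sup>2) / T)
        - 2 * rate * ((row A r \<bullet> e) * G $ r))
      = (\<Sum>r<n. denom r) * ((\<sigma>\<^sup>2 * (vnorm G)\<^sup>2 + (vnorm e)\<^sup>2) / T)
        - 2 * rate * (\<Sum>r<n. (row A r \<bullet> e) * G $ r)"
    by (simp only: sum_subtractf sum_distrib_left sum_distrib_right)
  also have "\<dots> = \<sigma>\<^sup>2 * (vnorm G)\<^sup>2 + (vnorm e)\<^sup>2 - 2 * rate * (g \<bullet> e)"
    using T_pos by (simp add: sum_cross sum_denom)
  also have "\<dots> \<le> (1 - rate) * (\<sigma>\<^sup>2 * (vnorm (dual *\<^sub>v p))\<^sup>2 + (vnorm q)\<^sup>2)"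
  proof -
    have "dual *\<^sub>v g = (1 - rate) \<cdot>\<^sub>v (dual *\<^sub>v p) + rate \<cdot>\<^sub>v (dual *\<^sub>v e)"
      unfolding g_def beta_eq
      using p e by (simp add: mult_add_distrib_mat_vec[OF dual_carrier] mult_mat_vec[OF dual_carrier])
    then have "(vnorm G)\<^sup>2 \<le> (1 - rate) * (vnorm (dual *\<^sub>v p))\<^sup>2 + rate * (vnorm (dual *\<^sub>v e))\<^sup>2"
      using vnorm_sq_convex[of "dual *\<^sub>v p" n "dual *\<^sub>v e" rate] p e rate_pos rate_le_1
      by (simp add: G_def)
    then have "\<sigma>\<^sup>2 * (vnorm G)\<^sup>2
        \<le> \<sigma>\<^sup>2 * ((1 - rate) * (vnorm (dual *\<^sub>v p))\<^sup>2 + rate * (vnorm (dual *\<^sub>v e))\<^sup>2)"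
      by (intro mult_left_mono) auto
    moreover have "rate * (\<sigma> * vnorm (dual *\<^sub>v e))\<^sup>2 \<le> rate * (vnorm e)\<^sup>2"
      using sigma_dual_le[OF e] rate_pos sigma_pos by (intro mult_left_mono power_mono) auto
    ultimately have GG: "\<sigma>\<^sup>2 * (vnorm G)\<^sup>2
        \<le> (1 - rate) * (\<sigma>\<^sup>2 * (vnorm (dual *\<^sub>v p))\<^sup>2) + rate * (vnorm e)\<^sup>2"
      by (simp add: power_mult_distrib algebra_simps)
    have "(1 + rate) * \<alpha> = rate" "(1 + rate) * (1 - \<alpha>) = 1"
      using rate_pos by (simp_all add: alpha_eq field_simps)
    then have "(1 + rate) * (e \<bullet> e) = rate * (p \<bullet> e) + q \<bullet> e"
    proof -
      assume a: "(1 + rate) * \<alpha> = rate" "(1 + rate) * (1 - \<alpha>) = 1"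
      have "e \<bullet> e = \<alpha> * (p \<bullet> e) + (1 - \<alpha>) * (q \<bullet> e)"
        using p q e by (subst (1) e_def) (simp add: add_scalar_prod_distrib[of _ n])
      then have "(1 + rate) * (e \<bullet> e)
          = ((1 + rate) * \<alpha>) * (p \<bullet> e) + ((1 + rate) * (1 - \<alpha>)) * (q \<bullet> e)"
        by (simp only: distrib_left mult.assoc)
      then show ?thesis by (simp only: a mult_1)
    qed
    then have pe: "rate * (p \<bullet> e) = (1 + rate) * (vnorm e)\<^sup>2 - q \<bullet> e"
      by (simp add: vnorm_sq)
    have "g \<bullet> e = (1 - rate) * (p \<bullet> e) + rate * (vnorm e)\<^sup>2"
      using p e by (subst g_def) (simp add: add_scalar_prod_distrib[of _ n] beta_eq vnorm_sq)
    then have "2 * rate * (g \<bullet> e) = 2 * (1 - rate) * (rate * (p \<bullet> e)) + 2 * rate * rate * (vnorm e)\<^sup>2"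
      by (simp only:) (simp add: algebra_simps)
    also have "\<dots> = 2 * (vnorm e)\<^sup>2 - 2 * (1 - rate) * (q \<bullet> e)"
      unfolding pe by (simp add: algebra_simps)
    finally have cross: "2 * rate * (g \<bullet> e) = 2 * (vnorm e)\<^sup>2 - (1 - rate) * (2 * (q \<bullet> e))"
      by (simp add: algebra_simps)
    have "2 * (q \<bullet> e) \<le> (vnorm q)\<^sup>2 + (vnorm e)\<^sup>2"
      using zero_le_power2[of "vnorm (q - 1 \<cdot>\<^sub>v e)"] unfolding vnorm_sq_minus_smult[OF q e] by simp
    then have "(1 - rate) * (2 * (q \<bullet> e)) \<le> (1 - rate) * ((vnorm q)\<^sup>2 + (vnorm e)\<^sup>2)"
      using rate_le_1 by (intro mult_left_mono) auto
    with GG cross show ?thesis by (simp add: algebra_simps)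
  qed
  finally show ?thesis
    by (rule order_trans[rotated]) (rule sum_mono, rule row_bound, simp)
qed

end

section \<open>Rounding errors of the vector operations\<close>

definition rep_vec :: "fp_arith \<Rightarrow> nat \<Rightarrow> real vec \<Rightarrow> bool" where
  "rep_vec M n v \<longleftrightarrow> v \<in> carrier_vec n \<and> (\<forall>i<n. representable M (v $ i))"

lemma rep_vec_carrier: "rep_vec M n v \<Longrightarrow> v \<in> carrier_vec n"
  by (simp add: rep_vec_def)

lemma rep_vec_index: "rep_vec M n v \<Longrightarrow> i < n \<Longrightarrow> representable M (v $ i)"
  by (simp add: rep_vec_def)

locale fp_model =
  fixes M :: fp_arith and u :: real
  assumes model: "standard_model M u"
begin

lemma u_pos: "0 < u"
  using model by (simp add: standard_model_def)

lemma representable_0: "representable M 0"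
  using model by (simp add: standard_model_def representable_def)
    (metis abs_ge_zero abs_le_zero_iff abs_zero diff_zero mult_zero_right)

lemma
  assumes "representable M a" "representable M b"
  shows fadd_rep: "representable M (fadd M a b)"
    and fadd_err: "\<bar>fadd M a b - (a + b)\<bar> \<le> u * \<bar>a + b\<bar>"
    and fsub_rep: "representable M (fsub M a b)"
    and fsub_err: "\<bar>fsub M a b - (a - b)\<bar> \<le> u * \<bar>a - b\<bar>"
    and fmul_rep: "representable M (fmul M a b)"
    and fmul_err: "\<bar>fmul M a b - a * b\<bar> \<le> u * \<bar>a * b\<bar>"
    and fdiv_rep: "b \<noteq> 0 \<Longrightarrow> representable M (fdiv M a b)"
    and fdiv_err: "b \<noteq> 0 \<Longrightarrow> \<bar>fdiv M a b - a / b\<bar> \<le> u * \<bar>a / b\<bar>"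
  using model assms unfolding standard_model_def fp_result_def by blast+

lemma rep_vec_zero: "rep_vec M n (0\<^sub>v n)"
  by (simp add: rep_vec_def representable_0)

lemma
  assumes "rep_vec M n v" "rep_vec M n w"
  shows fl_vadd_rep: "rep_vec M n (fl_vadd M v w)"
    and fl_vadd_err: "vnorm (fl_vadd M v w - (v + w)) \<le> u * vnorm (v + w)"
    and fl_vsub_rep: "rep_vec M n (fl_vsub M v w)"
    and fl_vsub_err: "vnorm (fl_vsub M v w - (v - w)) \<le> u * vnorm (v - w)"
proof -
  have c: "v \<in> carrier_vec n" "w \<in> carrier_vec n"
    using assms by (simp_all add: rep_vec_def)
  show "rep_vec M n (fl_vadd M v w)" "rep_vec M n (fl_vsub M v w)"
    using assms by (auto simp: rep_vec_def fl_vadd_def fl_vsub_def intro!: fadd_rep fsub_rep)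
  show "vnorm (fl_vadd M v w - (v + w)) \<le> u * vnorm (v + w)"
    using assms c u_pos
    by (intro vnorm_mono_scaled) (auto simp: fl_vadd_def rep_vec_def intro!: fadd_err)
  show "vnorm (fl_vsub M v w - (v - w)) \<le> u * vnorm (v - w)"
    using assms c u_pos
    by (intro vnorm_mono_scaled) (auto simp: fl_vsub_def rep_vec_def intro!: fsub_err)
qed

text \<open>Propagation of errors already present in the operands.\<close>

lemma
  assumes "rep_vec M n v'" "rep_vec M n w'" "v \<in> carrier_vec n" "w \<in> carrier_vec n"
    and E: "vnorm (v' - v) \<le> E1" "vnorm (w' - w) \<le> E2"
      "u * (vnorm v + vnorm w + E1 + E2) \<le> E3"
  shows fl_vadd_approx:
      "vnorm (fl_vadd M v' w' - (v + w)) \<le> E1 + E2 + E3"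
    and fl_vsub_approx:
      "vnorm (fl_vsub M v' w' - (v - w)) \<le> E1 + E2 + E3"
proof -
  have c: "v' \<in> carrier_vec n" "w' \<in> carrier_vec n"
    "fl_vadd M v' w' \<in> carrier_vec n" "fl_vsub M v' w' \<in> carrier_vec n"
    using assms(1,2) fl_vadd_rep[OF assms(1,2)] fl_vsub_rep[OF assms(1,2)]
    by (auto dest: rep_vec_carrier)
  have v': "vnorm v' \<le> vnorm v + E1" and w': "vnorm w' \<le> vnorm w + E2"
    using vnorm_le_add_dist[of v' n v] vnorm_le_add_dist[of w' n w] c assms(3,4) E by auto
  have "(v' + w') - (v + w) = (v' - v) + (w' - w)" using c assms(3,4) by auto
  then have "vnorm ((v' + w') - (v + w)) \<le> E1 + E2"
    using vnorm_triangle[of "v' - v" "w' - w"] E assms(3,4) by simp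
  moreover have "u * vnorm (v' + w') \<le> u * (vnorm v + vnorm w + E1 + E2)"
    using vnorm_triangle[of v' w'] c v' w' u_pos
    by (intro mult_left_mono) auto
  ultimately show "vnorm (fl_vadd M v' w' - (v + w)) \<le> E1 + E2 + E3"
    using vnorm_dist_triangle[of "fl_vadd M v' w'" n "v' + w'" "v + w"] c assms(3,4)
      fl_vadd_err[OF assms(1,2)] E(3) by simp
  have "(v' - w') - (v - w) = (v' - v) - (w' - w)" using c assms(3,4) by auto
  then have "vnorm ((v' - w') - (v - w)) \<le> E1 + E2"
    using vnorm_triangle_minus[of "v' - v" "w' - w"] E assms(3,4) by simp
  moreover have "u * vnorm (v' - w') \<le> u * (vnorm v + vnorm w + E1 + E2)"
    using vnorm_triangle_minus[of v' w'] c v' w' u_pos by (intro mult_left_mono) auto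
  ultimately show "vnorm (fl_vsub M v' w' - (v - w)) \<le> E1 + E2 + E3"
    using vnorm_dist_triangle[of "fl_vsub M v' w'" n "v' - w'" "v - w"] c assms(3,4)
      fl_vsub_err[OF assms(1,2)] E(3) by simp
qed

lemma
  assumes "rep_vec M n v" "representable M c"
  shows fl_smult_rep: "rep_vec M n (fl_smult M c v)"
    and fl_smult_err: "vnorm (fl_smult M c v - c \<cdot>\<^sub>v v) \<le> u * (\<bar>c\<bar> * vnorm v)"
proof -
  have c: "v \<in> carrier_vec n" using assms by (simp add: rep_vec_def)
  show "rep_vec M n (fl_smult M c v)"
    using assms by (auto simp: rep_vec_def fl_smult_def intro!: fmul_rep)
  have "vnorm (fl_smult M c v - c \<cdot>\<^sub>v v) \<le> u * vnorm (c \<cdot>\<^sub>v v)"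
    using assms c u_pos
    by (intro vnorm_mono_scaled) (auto simp: fl_smult_def rep_vec_def intro!: fmul_err)
  then show "vnorm (fl_smult M c v - c \<cdot>\<^sub>v v) \<le> u * (\<bar>c\<bar> * vnorm v)" by simp
qed

lemma fl_smult_approx:
  assumes "rep_vec M n v'" "representable M c" "v \<in> carrier_vec n"
    and E: "vnorm (v' - v) \<le> E" "u * (\<bar>c\<bar> * (vnorm v + E)) \<le> E'"
  shows "vnorm (fl_smult M c v' - c \<cdot>\<^sub>v v) \<le> \<bar>c\<bar> * E + E'"
proof -
  have c: "v' \<in> carrier_vec n" "fl_smult M c v' \<in> carrier_vec n"
    using assms(1) fl_smult_rep[OF assms(1,2)] by (auto dest: rep_vec_carrier)
  have v': "vnorm v' \<le> vnorm v + E"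
    using vnorm_le_add_dist[of v' n v] c assms(3) E by auto
  have "c \<cdot>\<^sub>v v' - c \<cdot>\<^sub>v v = c \<cdot>\<^sub>v (v' - v)"
    using c assms(3) by (auto simp: algebra_simps)
  then have "vnorm (c \<cdot>\<^sub>v v' - c \<cdot>\<^sub>v v) \<le> \<bar>c\<bar> * E"
    using E by (simp add: mult_left_mono)
  moreover have "u * (\<bar>c\<bar> * vnorm v') \<le> u * (\<bar>c\<bar> * (vnorm v + E))"
    using v' u_pos by (intro mult_left_mono) auto
  ultimately show ?thesis
    using vnorm_dist_triangle[of "fl_smult M c v'" n "c \<cdot>\<^sub>v v'" "c \<cdot>\<^sub>v v"] c assms(3)
      fl_smult_err[OF assms(1,2)] E(2) by simp
qed

text \<open>The partial sum of \<open>k\<close> terms has relative error \<open>(1 + u)^k - 1\<close> in the sum of the absolute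
  values; the count is \<open>k\<close> and not \<open>k + 1\<close> because the first product is not added to anything.\<close>

lemma fl_dot_partial:
  assumes "rep_vec M n v" "rep_vec M n w" "1 \<le> k" "k \<le> n"
  shows "representable M (foldl (\<lambda>s i. fadd M s (fmul M (v $ i) (w $ i))) (fmul M (v $ 0) (w $ 0)) [1..<k])
    \<and> \<bar>foldl (\<lambda>s i. fadd M s (fmul M (v $ i) (w $ i))) (fmul M (v $ 0) (w $ 0)) [1..<k]
        - (\<Sum>i<k. v $ i * w $ i)\<bar> \<le> ((1 + u) ^ k - 1) * (\<Sum>i<k. \<bar>v $ i\<bar> * \<bar>w $ i\<bar>)"
  using assms(3,4)
proof (induction k rule: nat_induct_at_least)
  case base
  then show ?case
    using fmul_rep[of "v $ 0" "w $ 0"] fmul_err[of "v $ 0" "w $ 0"] assms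
    by (simp add: rep_vec_index abs_mult)
next
  case (Suc k)
  let ?s = "foldl (\<lambda>s i. fadd M s (fmul M (v $ i) (w $ i))) (fmul M (v $ 0) (w $ 0)) [1..<k]"
  define s where "s = ?s"
  define f where "f = fmul M (v $ k) (w $ k)"
  define a where "a = (\<Sum>i<k. v $ i * w $ i)"
  define B where "B = (\<Sum>i<k. \<bar>v $ i\<bar> * \<bar>w $ i\<bar>)"
  define b where "b = v $ k * w $ k"
  define h where "h = (1 + u) ^ k - 1"
  have IH: "representable M s" "\<bar>s - a\<bar> \<le> h * B"
    using Suc by (simp_all add: s_def a_def B_def h_def)
  have k: "k < n" using Suc by simp
  have f: "representable M f" "\<bar>f - b\<bar> \<le> u * \<bar>b\<bar>"
    using fmul_rep[of "v $ k" "w $ k"] fmul_err[of "v $ k" "w $ k"] assms k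
    by (auto simp: rep_vec_index f_def b_def)
  have B0: "0 \<le> B" by (auto simp: B_def intro!: sum_nonneg)
  have aB: "\<bar>a\<bar> \<le> B"
    unfolding a_def B_def by (rule order_trans[OF sum_abs]) (simp add: abs_mult)
  have uh: "u \<le> h"
  proof -
    have "(1 + u) ^ 1 \<le> (1 + u) ^ k" using u_pos Suc by (intro power_increasing) auto
    then show ?thesis by (simp add: h_def)
  qed
  have "\<bar>fadd M s f - (s + f)\<bar> \<le> u * \<bar>s + f\<bar>" by (rule fadd_err[OF IH(1) f(1)])
  also have "\<dots> \<le> u * (B + \<bar>b\<bar> + h * B + u * \<bar>b\<bar>)"
    using IH(2) f(2) aB u_pos by (intro mult_left_mono) linarith+
  finally have "\<bar>fadd M s f - (a + b)\<bar>
      \<le> u * (B + \<bar>b\<bar> + h * B + u * \<bar>b\<bar>) + h * B + u * \<bar>b\<bar>"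
    using IH(2) f(2) by linarith
  also have "\<dots> = (u + h + u * h) * B + (u + u + u * u) * \<bar>b\<bar>"
    by (simp add: algebra_simps)
  also have "\<dots> \<le> (u + h + u * h) * B + (u + h + u * h) * \<bar>b\<bar>"
    using uh u_pos by (intro add_left_mono mult_right_mono add_mono mult_left_mono) auto
  also have "\<dots> = ((1 + u) ^ Suc k - 1) * (B + \<bar>b\<bar>)"
    by (simp add: h_def algebra_simps)
  finally show ?case
    using Suc.hyps fadd_rep[OF IH(1) f(1)]
    by (simp add: s_def f_def a_def B_def b_def abs_mult)
qed

lemma power_one_plus_u_le:
  assumes "real n * u \<le> 1"
  shows "(1 + u) ^ n - 1 \<le> 2 * (real n * u)"
proof -
  have "(1 + u) ^ n \<le> exp u ^ n"
    using u_pos by (intro power_mono) (auto simp: exp_ge_add_one_self)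
  also have "\<dots> = exp (real n * u)" by (simp add: exp_of_nat_mult)
  also have "\<dots> \<le> 1 + real n * u + (real n * u)\<^sup>2"
    using assms u_pos by (intro exp_bound) auto
  also have "(real n * u)\<^sup>2 \<le> real n * u"
    unfolding power2_eq_square using assms u_pos mult_right_mono[OF assms, of "real n * u"] by simp
  finally show ?thesis by linarith
qed

lemma
  assumes v: "rep_vec M n v" and w: "rep_vec M n w" and n: "1 \<le> n" and small: "real n * u \<le> 1"
  shows fl_dot_rep: "representable M (fl_dot M v w)"
    and fl_dot_err: "\<bar>fl_dot M v w - v \<bullet> w\<bar> \<le> 2 * (real n * u) * (vnorm v * vnorm w)"
proof -
  have c: "dim_vec v = n" "dim_vec w = n" using v w by (auto simp: rep_vec_def)
  note D = fl_dot_partial[OF v w n order_refl]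
  show "representable M (fl_dot M v w)" using D by (simp add: fl_dot_def c)
  have "\<bar>fl_dot M v w - v \<bullet> w\<bar> \<le> ((1 + u) ^ n - 1) * (\<Sum>i<n. \<bar>v $ i\<bar> * \<bar>w $ i\<bar>)"
    using D by (simp add: fl_dot_def scalar_prod_def c atLeast0LessThan)
  also have "\<dots> \<le> 2 * (real n * u) * (vnorm v * vnorm w)"
    using power_one_plus_u_le[OF small] abs_sum_le_vnorm[of w v] c u_pos
    by (intro mult_mono) (auto intro: sum_nonneg)
  finally show "\<bar>fl_dot M v w - v \<bullet> w\<bar> \<le> 2 * (real n * u) * (vnorm v * vnorm w)" .
qed

lemma
  assumes A: "A \<in> carrier_mat n n" "\<And>i. i < n \<Longrightarrow> rep_vec M n (row A i)"
    and x: "rep_vec M n x" and n: "1 \<le> n" and small: "real n * u \<le> 1"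
  shows fl_matvec_rep: "rep_vec M n (fl_matvec M A x)"
    and fl_matvec_err: "vnorm (fl_matvec M A x - A *\<^sub>v x) \<le> frob_norm A * (2 * (real n * u) * vnorm x)"
proof -
  show "rep_vec M n (fl_matvec M A x)"
    using A fl_dot_rep[OF _ x n small] by (auto simp: rep_vec_def fl_matvec_def)
  show "vnorm (fl_matvec M A x - A *\<^sub>v x) \<le> frob_norm A * (2 * (real n * u) * vnorm x)"
    using A u_pos fl_dot_err[OF A(2) x n small]
    by (intro vnorm_le_frob_norm) (auto simp: fl_matvec_def mult_ac)
qed

end

section \<open>One computed step of ARK\<close>

text \<open>The constant in the smallness assumption leaves room for the crude absolute constants of the
  error bounds; the exponent of \<open>n\<close> pays for \<open>\<epsilon> = n u\<close> and for the factor \<open>sqrt n\<close> in the bound on the rate.\<close>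

locale fp_ark = ark_system n A lam + fp_model M u
  for n A lam M u +
  assumes A_rep: "\<And>i j. i < n \<Longrightarrow> j < n \<Longrightarrow> representable M (A $$ (i, j))"
    and params_rep: "params_representable M lam \<mu> \<nu>"
    and small: "\<kappa>\<^sup>2 * u \<le> 1 / (1000000 * (real n)\<^sup>2)"
begin

definition \<epsilon> where "\<epsilon> = real n * u"

lemma row_rep: "i < n \<Longrightarrow> rep_vec M n (row A i)"
  using A_rep A_carrier by (auto simp: rep_vec_def)

lemma eps_pos: "0 < \<epsilon>"
  using u_pos dim_pos by (simp add: \<epsilon>_def)

lemma u_le_eps: "u \<le> \<epsilon>"
  using u_pos dim_pos mult_right_mono[of 1 "real n" u] by (simp add: \<epsilon>_def)

lemma eps_kappa_sq: "1000000 * real n * (\<epsilon> * \<kappa>\<^sup>2) \<le> 1"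
  using small dim_pos by (simp add: \<epsilon>_def power2_eq_square field_simps)

lemma eps_kappa_small: "1000000 * (\<epsilon> * \<kappa>) \<le> 1"
proof -
  have "1 * (\<epsilon> * \<kappa>) \<le> \<kappa> * (\<epsilon> * \<kappa>)"
    using kappa_ge_1 eps_pos by (intro mult_right_mono) auto
  also have "\<dots> = 1 * (\<epsilon> * \<kappa>\<^sup>2)" by (simp add: power2_eq_square)
  also have "\<dots> \<le> real n * (\<epsilon> * \<kappa>\<^sup>2)"
    using dim_pos eps_pos by (intro mult_right_mono) auto
  finally show ?thesis using eps_kappa_sq by linarith
qed

lemma eps_small: "1000000 * \<epsilon> \<le> 1"
proof -
  have "\<epsilon> * 1 \<le> \<epsilon> * \<kappa>" using kappa_ge_1 eps_pos by (intro mult_left_mono) auto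
  then show ?thesis using eps_kappa_small by linarith
qed

text \<open>The error committed per step is small against the contraction per step: here the square of \<open>\<kappa>\<close>
  enters, one factor from the error and one from the reciprocal of the rate.\<close>

lemma eps_kappa_rate: "100000 * (\<epsilon> * \<kappa>) \<le> rate"
proof -
  have "sqrt (real n) \<le> real n"
    using dim_pos by (intro real_le_lsqrt) (auto simp: power2_eq_square)
  then have "4 * \<kappa> * sqrt (real n) * rate \<le> 4 * \<kappa> * real n * rate"
    using kappa_ge_1 rate_pos by (intro mult_left_mono mult_right_mono) auto
  then have 1: "1 \<le> 4 * \<kappa> * real n * rate" using rate_ge by linarith
  have "\<epsilon> * \<kappa> * 1 \<le> \<epsilon> * \<kappa> * (4 * \<kappa> * real n * rate)"
    using 1 eps_pos kappa_ge_1 by (intro mult_left_mono) auto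
  also have "\<dots> = 4 * rate * (real n * (\<epsilon> * \<kappa>\<^sup>2))"
    by (simp add: power2_eq_square)
  also have "\<dots> \<le> 4 * rate * (1 / 1000000)"
    using eps_kappa_sq rate_pos by (intro mult_left_mono) auto
  finally show ?thesis using rate_pos by simp
qed

lemma u_mult_le: "0 \<le> X \<Longrightarrow> X \<le> Y \<Longrightarrow> u * X \<le> \<epsilon> * Y"
  using u_le_eps u_pos by (intro mult_mono) auto

lemma eps_mult_le: "0 \<le> X \<Longrightarrow> 100 * (\<epsilon> * X) \<le> X"
  using eps_small eps_pos mult_right_mono[of "100 * \<epsilon>" 1 X] by simp

lemma lam_rep: "representable M lam" and alpha_rep: "representable M \<alpha>"
  and one_minus_alpha_rep: "representable M (1 - \<alpha>)" and beta_rep: "representable M \<beta>"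
  and one_minus_beta_rep: "representable M (1 - \<beta>)" and gamma_rep: "representable M \<gamma>"
  using params_rep by (simp_all add: params_representable_def)

lemma
  assumes v: "rep_vec M n v" and y: "rep_vec M n y"
  shows fl_ark_z_rep: "rep_vec M n (fl_ark_z M \<mu> \<nu> (v, y))"
    and fl_ark_z_err: "vnorm (fl_ark_z M \<mu> \<nu> (v, y) - (\<alpha> \<cdot>\<^sub>v v + (1 - \<alpha>) \<cdot>\<^sub>v y))
      \<le> 3 * (\<epsilon> * (\<alpha> * vnorm v + (1 - \<alpha>) * vnorm y))"
proof -
  have c: "v \<in> carrier_vec n" "y \<in> carrier_vec n" using v y by (auto dest: rep_vec_carrier)
  note r = fl_smult_rep[OF v alpha_rep] fl_smult_rep[OF y one_minus_alpha_rep]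
  show "rep_vec M n (fl_ark_z M \<mu> \<nu> (v, y))"
    using fl_vadd_rep[OF r] by (simp add: fl_ark_z_def)
  define a b where "a = \<alpha> * vnorm v" and "b = (1 - \<alpha>) * vnorm y"
  have ab: "0 \<le> a" "0 \<le> b" using alpha_nonneg alpha_le_1 by (simp_all add: a_def b_def)
  define S where "S = a + b"
  have S0: "0 \<le> S" using ab by (simp add: S_def)
  have uS: "u * S \<le> \<epsilon> * S" by (rule u_mult_le[OF S0 order_refl])
  have uSS: "u * (S + u * S) \<le> \<epsilon> * (2 * S)"
    using uS eps_mult_le[OF S0] S0 mult_nonneg_nonneg[OF less_imp_le[OF u_pos] S0]
    by (intro u_mult_le) linarith+
  have "vnorm (fl_ark_z M \<mu> \<nu> (v, y) - (\<alpha> \<cdot>\<^sub>v v + (1 - \<alpha>) \<cdot>\<^sub>v y)) \<le> u * a + u * b + \<epsilon> * (2 * S)"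
    using fl_vadd_approx[OF r _ _ fl_smult_err[OF v alpha_rep] fl_smult_err[OF y one_minus_alpha_rep],
        of "\<epsilon> * (2 * S)"] uSS c alpha_nonneg alpha_le_1
    by (simp add: fl_ark_z_def a_def b_def S_def algebra_simps)
  also have "\<dots> \<le> 3 * (\<epsilon> * S)"
    using uS unfolding S_def distrib_left by linarith
  finally show "vnorm (fl_ark_z M \<mu> \<nu> (v, y) - (\<alpha> \<cdot>\<^sub>v v + (1 - \<alpha>) \<cdot>\<^sub>v y))
      \<le> 3 * (\<epsilon> * (\<alpha> * vnorm v + (1 - \<alpha>) * vnorm y))"
    unfolding S_def a_def b_def .
qed

lemma
  assumes r: "r < n"
  shows fl_denom_rep: "representable M (fadd M (fl_dot M (row A r) (row A r)) lam)"
    and fl_denom_err: "\<bar>fadd M (fl_dot M (row A r) (row A r)) lam - denom r\<bar> \<le> 4 * (\<epsilon> * denom r)"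
proof -
  have nu: "real n * u \<le> 1" using eps_small by (simp add: \<epsilon>_def)
  let ?a = "row A r" let ?d = "denom r"
  note D = fl_dot_rep[OF row_rep[OF r] row_rep[OF r] dim_pos nu]
    fl_dot_err[OF row_rep[OF r] row_rep[OF r] dim_pos nu]
  show "representable M (fadd M (fl_dot M ?a ?a) lam)" by (rule fadd_rep[OF D(1) lam_rep])
  have d: "0 < ?d" by (rule denom_pos[OF r])
  have 1: "\<bar>fl_dot M ?a ?a + lam - ?d\<bar> \<le> 2 * (\<epsilon> * ?d)"
  proof -
    have "\<bar>fl_dot M ?a ?a - ?a \<bullet> ?a\<bar> \<le> 2 * (\<epsilon> * (vnorm ?a)\<^sup>2)"
      using D(2) by (simp add: \<epsilon>_def power2_eq_square mult_ac)
    also have "\<dots> \<le> 2 * (\<epsilon> * ?d)"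
      using eps_pos lam_nonneg by (intro mult_left_mono) (auto simp: denom_def)
    finally show ?thesis by (simp add: denom_def vnorm_sq)
  qed
  have "u * \<bar>fl_dot M ?a ?a + lam\<bar> \<le> \<epsilon> * (2 * ?d)"
    using 1 d eps_mult_le[OF less_imp_le[OF d]] by (intro u_mult_le) linarith+
  then show "\<bar>fadd M (fl_dot M ?a ?a) lam - ?d\<bar> \<le> 4 * (\<epsilon> * ?d)"
    using fadd_err[OF D(1) lam_rep] 1 by linarith
qed

text \<open>The computed step length is compared with the exact one at the exact point \<open>z\<close>, so that the
  error of the computed \<open>z\<close> enters here and not in the contraction argument.\<close>

lemma
  assumes r: "r < n" and x: "x \<in> carrier_vec n" and c: "rep_vec M n (A *\<^sub>v x)"
    and z: "z \<in> carrier_vec n" and z': "rep_vec M n z'" and zz': "vnorm (z' - z) \<le> 3 * (\<epsilon> * R)"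
    and zR: "vnorm z \<le> R" "vnorm (z - x) \<le> R"
    and q_def: "q = fdiv M (fsub M (fl_dot M (row A r) z') ((A *\<^sub>v x) $ r))
      (fadd M (fl_dot M (row A r) (row A r)) lam)"
  shows fl_step_length_rep: "representable M q"
    and fl_step_length_err: "\<bar>q - (row A r \<bullet> (z - x)) / denom r\<bar>
      \<le> 14 * (\<epsilon> * R) * vnorm (row A r) / denom r"
    and step_length_le: "\<bar>(row A r \<bullet> (z - x)) / denom r\<bar> \<le> R * vnorm (row A r) / denom r"
proof -
  have nu: "real n * u \<le> 1" using eps_small by (simp add: \<epsilon>_def)
  let ?a = "row A r"
  define d where "d = denom r"
  define d' where "d' = fadd M (fl_dot M ?a ?a) lam"
  define na where "na = vnorm ?a"
  define \<rho> where "\<rho> = ?a \<bullet> (z - x)"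
  define t where "t = fl_dot M ?a z'"
  define \<rho>' where "\<rho>' = fsub M t ((A *\<^sub>v x) $ r)"
  define X where "X = na * R"
  have z'c: "z' \<in> carrier_vec n" using z' by (rule rep_vec_carrier)
  have R0: "0 \<le> R" using zR(1) vnorm_nonneg[of z] by linarith
  have X0: "0 \<le> X" using R0 by (simp add: X_def na_def)
  have eX0: "0 \<le> \<epsilon> * X" using X0 eps_pos by simp
  have eX: "100 * (\<epsilon> * X) \<le> X" by (rule eps_mult_le[OF X0])
  have eR: "100 * (\<epsilon> * R) \<le> R" by (rule eps_mult_le[OF R0])
  have d: "0 < d" using denom_pos[OF r] by (simp add: d_def)
  have d': "representable M d'" "\<bar>d' - d\<bar> \<le> 4 * (\<epsilon> * d)"
    using fl_denom_rep[OF r] fl_denom_err[OF r] by (simp_all add: d_def d'_def)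
  have ed: "100 * (\<epsilon> * d) \<le> d" using d by (intro eps_mult_le) auto
  then have d'pos: "24 / 25 * d \<le> d'" using d' by linarith
  have c_eq: "(A *\<^sub>v x) $ r = ?a \<bullet> x" using r by simp
  have t: "representable M t" "\<bar>t - ?a \<bullet> z'\<bar> \<le> 2 * \<epsilon> * (na * vnorm z')"
    using fl_dot_rep[OF row_rep[OF r] z' dim_pos nu] fl_dot_err[OF row_rep[OF r] z' dim_pos nu]
    by (simp_all add: t_def na_def \<epsilon>_def)
  have "vnorm z' \<le> 103 / 100 * R" using vnorm_le_add_dist[OF z'c z] zz' zR eR by linarith
  then have "2 * \<epsilon> * (na * vnorm z') \<le> 2 * \<epsilon> * (na * (103 / 100 * R))"
    using eps_pos by (intro mult_left_mono) (auto simp: na_def)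
  then have t2: "\<bar>t - ?a \<bullet> z'\<bar> \<le> 206 / 100 * (\<epsilon> * X)"
    using t(2) by (simp add: X_def mult_ac)
  have "?a \<bullet> z' - ?a \<bullet> z = ?a \<bullet> (z' - z)"
    using z z'c by (simp add: scalar_prod_minus_distrib[of _ n])
  moreover have "\<bar>?a \<bullet> (z' - z)\<bar> \<le> na * (3 * (\<epsilon> * R))"
    using scalar_prod_le_vnorm[of "z' - z" ?a] z mult_left_mono[OF zz', of na]
    by (simp add: na_def)
  moreover have "na * (3 * (\<epsilon> * R)) = 3 * (\<epsilon> * X)" by (simp add: X_def)
  ultimately have t3: "\<bar>t - ?a \<bullet> z\<bar> \<le> 506 / 100 * (\<epsilon> * X)"
    using t2 by linarith
  have rho_eq: "\<rho> = ?a \<bullet> z - ?a \<bullet> x"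
    using z x by (simp add: \<rho>_def scalar_prod_minus_distrib[of _ n])
  have rho_le: "\<bar>\<rho>\<bar> \<le> X"
    using scalar_prod_le_vnorm[of "z - x" ?a] x mult_left_mono[OF zR(2), of na]
    by (simp add: \<rho>_def X_def na_def)
  have rho': "representable M \<rho>'" "\<bar>\<rho>' - (t - ?a \<bullet> x)\<bar> \<le> u * \<bar>t - ?a \<bullet> x\<bar>"
    using fsub_rep[OF t(1) rep_vec_index[OF c r]] fsub_err[OF t(1) rep_vec_index[OF c r]]
    by (simp_all add: \<rho>'_def c_eq)
  have "u * \<bar>t - ?a \<bullet> x\<bar> \<le> \<epsilon> * (106 / 100 * X)"
    using t3 rho_eq rho_le eX by (intro u_mult_le) linarith+
  then have rho_err: "\<bar>\<rho>' - \<rho>\<bar> \<le> 7 * (\<epsilon> * X)"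
    using rho'(2) t3 rho_eq eX0 by linarith
  have "\<rho>' / d' - \<rho> / d = ((\<rho>' - \<rho>) * d + \<rho> * (d - d')) / (d * d')"
    using d d'pos by (simp add: field_simps)
  also have "\<bar>\<dots>\<bar> \<le> (7 * (\<epsilon> * X) * d + X * (4 * (\<epsilon> * d))) / (d * (24 / 25 * d))"
    unfolding abs_divide
  proof (rule frac_le)
    have "\<bar>(\<rho>' - \<rho>) * d\<bar> \<le> 7 * (\<epsilon> * X) * d"
      using rho_err d by (simp add: abs_mult)
    moreover have "\<bar>\<rho> * (d - d')\<bar> \<le> X * (4 * (\<epsilon> * d))"
      unfolding abs_mult using rho_le d' by (intro mult_mono) (auto simp: abs_minus_commute)
    ultimately show "\<bar>(\<rho>' - \<rho>) * d + \<rho> * (d - d')\<bar> \<le> 7 * (\<epsilon> * X) * d + X * (4 * (\<epsilon> * d))"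
      by linarith
    show "d * (24 / 25 * d) \<le> \<bar>d * d'\<bar>"
      using d d'pos by (simp add: abs_mult)
  qed (use d X0 eps_pos in auto)
  also have "\<dots> = 275 / 24 * (\<epsilon> * X) / d"
    using d by (simp add: field_simps)
  also have "\<dots> \<le> 12 * (\<epsilon> * X) / d"
    using d X0 eps_pos by (intro divide_right_mono) auto
  finally have quot: "\<bar>\<rho>' / d' - \<rho> / d\<bar> \<le> 12 * (\<epsilon> * X) / d" .
  have d'nz: "d' \<noteq> 0" using d d'pos by auto
  have q: "q = fdiv M \<rho>' d'" by (simp add: q_def \<rho>'_def t_def d'_def)
  show "representable M q" unfolding q by (rule fdiv_rep[OF rho'(1) d'(1) d'nz])
  have rho_d: "\<bar>\<rho> / d\<bar> \<le> X / d"
    using rho_le d by (simp add: divide_right_mono)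
  then show "\<bar>(row A r \<bullet> (z - x)) / denom r\<bar> \<le> R * vnorm (row A r) / denom r"
    by (simp add: \<rho>_def d_def X_def na_def mult.commute)
  have e1: "100 * (12 * (\<epsilon> * X) / d) \<le> 12 * (X / d)"
    using divide_right_mono[OF eX, of d] d by simp
  have "u * \<bar>\<rho>' / d'\<bar> \<le> \<epsilon> * (2 * (X / d))"
    using quot rho_d e1 X0 d by (intro u_mult_le) linarith+
  then have "\<bar>q - \<rho> / d\<bar> \<le> 12 * (\<epsilon> * X) / d + \<epsilon> * (2 * (X / d))"
    using fdiv_err[OF rho'(1) d'(1) d'nz] quot unfolding q by linarith
  also have "\<dots> = 14 * (\<epsilon> * R) * na / d" by (simp add: X_def field_simps)
  finally show "\<bar>q - (row A r \<bullet> (z - x)) / denom r\<bar> \<le> 14 * (\<epsilon> * R) * vnorm (row A r) / denom r"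
    by (simp add: \<rho>_def d_def na_def)
qed

text \<open>The computed step is compared with the exact step from the same computed \<open>v\<close> and \<open>y\<close>. The scale \<open>R\<close>
  bounds \<open>|z|\<close>, \<open>|z - x|\<close> and hence \<open>|w|\<close>, since a Kaczmarz step is never longer than the distance to the
  solution.\<close>

lemma fl_ark_step_err:
  assumes r: "r < n" and x: "x \<in> carrier_vec n" and c: "rep_vec M n (A *\<^sub>v x)"
    and v: "rep_vec M n v" and y: "rep_vec M n y"
    and z_def: "z = \<alpha> \<cdot>\<^sub>v v + (1 - \<alpha>) \<cdot>\<^sub>v y"
    and w_def: "w = ((row A r \<bullet> (z - x)) / denom r) \<cdot>\<^sub>v row A r"
    and R_def: "R = vnorm x + (\<alpha> * vnorm v + (1 - \<alpha>) * vnorm y)"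
    and step: "fl_ark_step M A (A *\<^sub>v x) lam \<mu> \<nu> r (v, y) = (v', y')"
  shows "rep_vec M n v'" "rep_vec M n y'"
    "vnorm (y' - (z - w)) \<le> 22 * (\<epsilon> * R)"
    "vnorm (v' - (\<beta> \<cdot>\<^sub>v v + (1 - \<beta>) \<cdot>\<^sub>v z - \<gamma> \<cdot>\<^sub>v w)) \<le> 20 * (\<epsilon> * (vnorm v + (1 + \<gamma>) * R))"
proof -
  let ?a = "row A r"
  define z' where "z' = fl_ark_z M \<mu> \<nu> (v, y)"
  define q where "q = fdiv M (fsub M (fl_dot M ?a z') ((A *\<^sub>v x) $ r))
      (fadd M (fl_dot M ?a ?a) lam)"
  define w' where "w' = fl_smult M q ?a"
  have y'_eq: "y' = fl_vsub M z' w'" and v'_eq: "v' = fl_vsub M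
      (fl_vadd M (fl_smult M \<beta> v) (fl_smult M (1 - \<beta>) z')) (fl_smult M \<gamma> w')"
    using step unfolding fl_ark_step_def Let_def w'_def q_def z'_def by auto
  have vc: "v \<in> carrier_vec n" and yc: "y \<in> carrier_vec n"
    using v y by (auto dest: rep_vec_carrier)
  have zc: "z \<in> carrier_vec n" and wc: "w \<in> carrier_vec n"
    using vc yc by (simp_all add: z_def w_def)
  have z_le: "vnorm z \<le> \<alpha> * vnorm v + (1 - \<alpha>) * vnorm y"
    using vnorm_triangle[of "\<alpha> \<cdot>\<^sub>v v" "(1 - \<alpha>) \<cdot>\<^sub>v y"] vc yc alpha_nonneg alpha_le_1
    by (simp add: z_def)
  have zR: "vnorm z \<le> R" "vnorm (z - x) \<le> R" and R0: "0 \<le> R"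
  proof -
    have "vnorm (z - x) \<le> vnorm z + vnorm x"
      using zc x by (intro vnorm_triangle_minus) simp
    then show "vnorm z \<le> R" "vnorm (z - x) \<le> R" "0 \<le> R"
      using z_le vnorm_nonneg[of x] vnorm_nonneg[of z] unfolding R_def by linarith+
  qed
  have eR: "100 * (\<epsilon> * R) \<le> R" by (rule eps_mult_le[OF R0])
  have eR0: "0 \<le> \<epsilon> * R" using R0 eps_pos by simp
  have z': "rep_vec M n z'" unfolding z'_def by (rule fl_ark_z_rep[OF v y])
  have zerr: "vnorm (z' - z) \<le> 3 * (\<epsilon> * R)"
  proof -
    have "\<epsilon> * (\<alpha> * vnorm v + (1 - \<alpha>) * vnorm y) \<le> \<epsilon> * R"
      using eps_pos by (intro mult_left_mono) (auto simp: R_def)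
    then show ?thesis using fl_ark_z_err[OF v y] by (simp add: z'_def z_def)
  qed
  note Q = fl_step_length_rep[OF r x c zc z' zerr zR q_def]
    fl_step_length_err[OF r x c zc z' zerr zR q_def] step_length_le[OF r x c zc z' zerr zR q_def]
  define d where "d = denom r"
  have d: "0 < d" "(vnorm ?a)\<^sup>2 \<le> d"
    using denom_pos[OF r] lam_nonneg by (auto simp: d_def denom_def)
  have times_norm: "C * vnorm ?a / d * vnorm ?a \<le> C" if "0 \<le> C" for C
    using mult_left_mono[OF d(2) that] d(1) by (simp add: power2_eq_square field_simps)
  define k where "k = (?a \<bullet> (z - x)) / d"
  have k: "\<bar>q - k\<bar> * vnorm ?a \<le> 14 * (\<epsilon> * R)" "\<bar>k\<bar> * vnorm ?a \<le> R"
  proof -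
    have "\<bar>q - k\<bar> * vnorm ?a \<le> 14 * (\<epsilon> * R) * vnorm ?a / d * vnorm ?a"
      using Q(2) by (intro mult_right_mono) (auto simp: k_def d_def)
    then show "\<bar>q - k\<bar> * vnorm ?a \<le> 14 * (\<epsilon> * R)"
      using times_norm[of "14 * (\<epsilon> * R)"] eR0 by linarith
    have "\<bar>k\<bar> * vnorm ?a \<le> R * vnorm ?a / d * vnorm ?a"
      using Q(3) unfolding k_def d_def by (rule mult_right_mono) simp
    then show "\<bar>k\<bar> * vnorm ?a \<le> R" using times_norm[OF R0] by linarith
  qed
  have w_le: "vnorm w \<le> R" using k(2) by (simp add: w_def k_def d_def)
  have w': "rep_vec M n w'" unfolding w'_def by (rule fl_smult_rep[OF row_rep[OF r] Q(1)])
  have werr: "vnorm (w' - w) \<le> 16 * (\<epsilon> * R)"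
  proof -
    have "\<bar>q\<bar> * vnorm ?a \<le> \<bar>k\<bar> * vnorm ?a + \<bar>q - k\<bar> * vnorm ?a"
      by (simp flip: distrib_right add: mult_right_mono)
    moreover have "0 \<le> \<bar>q\<bar> * vnorm ?a" by simp
    ultimately have "u * (\<bar>q\<bar> * vnorm ?a) \<le> \<epsilon> * (2 * R)"
      using k eR R0 by (intro u_mult_le) linarith+
    then have 1: "vnorm (w' - q \<cdot>\<^sub>v ?a) \<le> 2 * (\<epsilon> * R)"
      using fl_smult_err[OF row_rep[OF r] Q(1)] by (simp add: w'_def)
    have "q \<cdot>\<^sub>v ?a - w = (q - k) \<cdot>\<^sub>v ?a"
      by (auto simp: w_def k_def d_def algebra_simps)
    then have "vnorm (q \<cdot>\<^sub>v ?a - w) \<le> 14 * (\<epsilon> * R)" using k(1) by simp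
    then show ?thesis
      using 1 vnorm_dist_triangle[of w' n "q \<cdot>\<^sub>v ?a" w] rep_vec_carrier[OF w'] wc by simp
  qed
  show "rep_vec M n y'" unfolding y'_eq by (rule fl_vsub_rep[OF z' w'])
  have "u * (vnorm z + vnorm w + 3 * (\<epsilon> * R) + 16 * (\<epsilon> * R)) \<le> \<epsilon> * (3 * R)"
    using zR w_le eR eR0 R0 vnorm_nonneg[of z] vnorm_nonneg[of w] by (intro u_mult_le) linarith+
  then show "vnorm (y' - (z - w)) \<le> 22 * (\<epsilon> * R)"
    using fl_vsub_approx[OF z' w' zc wc zerr werr, of "\<epsilon> * (3 * R)"] unfolding y'_eq by linarith
  note bv = fl_smult_rep[OF v beta_rep] and bz = fl_smult_rep[OF z' one_minus_beta_rep]
    and gw = fl_smult_rep[OF w' gamma_rep]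
  note h = fl_vadd_rep[OF bv bz]
  show "rep_vec M n v'" unfolding v'_eq by (rule fl_vsub_rep[OF h gw])
  define nv where "nv = vnorm v"
  have nv0: "0 \<le> nv" by (simp add: nv_def)
  define Y where "Y = nv + R"
  have Y0: "0 \<le> Y" using nv0 R0 by (simp add: Y_def)
  have eY: "100 * (\<epsilon> * Y) \<le> Y" by (rule eps_mult_le[OF Y0])
  have eY0: "0 \<le> \<epsilon> * Y" using eps_pos Y0 by simp
  have eRY: "\<epsilon> * R + \<epsilon> * nv = \<epsilon> * Y" by (simp add: Y_def algebra_simps)
  have env: "0 \<le> \<epsilon> * nv" using eps_pos nv0 by simp
  have bnv: "\<beta> * nv \<le> nv" using mult_right_mono[OF beta_le_1 nv0] by simp
  have err1: "vnorm (fl_smult M \<beta> v - \<beta> \<cdot>\<^sub>v v) \<le> \<epsilon> * nv"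
  proof -
    have "u * (\<beta> * nv) \<le> \<epsilon> * nv" using bnv mult_nonneg_nonneg[OF beta_nonneg nv0] by (intro u_mult_le)
    then show ?thesis using fl_smult_err[OF v beta_rep] beta_nonneg by (simp add: nv_def)
  qed
  have b01: "\<bar>1 - \<beta>\<bar> \<le> 1" using beta_nonneg beta_le_1 by simp
  have err2: "vnorm (fl_smult M (1 - \<beta>) z' - (1 - \<beta>) \<cdot>\<^sub>v z) \<le> 5 * (\<epsilon> * R)"
  proof -
    have "\<bar>1 - \<beta>\<bar> * (vnorm z + 3 * (\<epsilon> * R)) \<le> 1 * (vnorm z + 3 * (\<epsilon> * R))"
      using b01 eR0 by (intro mult_right_mono add_nonneg_nonneg) auto
    also have "\<dots> \<le> 2 * R" unfolding mult_1 using zR eR eR0 R0 by linarith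
    finally have "u * (\<bar>1 - \<beta>\<bar> * (vnorm z + 3 * (\<epsilon> * R))) \<le> \<epsilon> * (2 * R)"
      using eps_pos R0 by (intro u_mult_le mult_nonneg_nonneg add_nonneg_nonneg) auto
    moreover have "\<bar>1 - \<beta>\<bar> * (3 * (\<epsilon> * R)) \<le> 1 * (3 * (\<epsilon> * R))"
      using b01 eR0 by (intro mult_right_mono) auto
    ultimately show ?thesis
      using fl_smult_approx[OF z' one_minus_beta_rep zc zerr, of "\<epsilon> * (2 * R)"] by linarith
  qed
  have zb: "vnorm ((1 - \<beta>) \<cdot>\<^sub>v z) \<le> R" and vb: "vnorm (\<beta> \<cdot>\<^sub>v v) \<le> nv"
    using mult_right_mono[OF b01, of "vnorm z"] zR bnv beta_nonneg by (auto simp: nv_def)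
  have hc: "\<beta> \<cdot>\<^sub>v v + (1 - \<beta>) \<cdot>\<^sub>v z \<in> carrier_vec n" using vc zc by simp
  have err3: "vnorm (fl_vadd M (fl_smult M \<beta> v) (fl_smult M (1 - \<beta>) z')
      - (\<beta> \<cdot>\<^sub>v v + (1 - \<beta>) \<cdot>\<^sub>v z)) \<le> 7 * (\<epsilon> * Y)"
  proof -
    have "u * (vnorm (\<beta> \<cdot>\<^sub>v v) + vnorm ((1 - \<beta>) \<cdot>\<^sub>v z) + \<epsilon> * nv + 5 * (\<epsilon> * R)) \<le> \<epsilon> * (2 * Y)"
    proof (rule u_mult_le)
      show "0 \<le> vnorm (\<beta> \<cdot>\<^sub>v v) + vnorm ((1 - \<beta>) \<cdot>\<^sub>v z) + \<epsilon> * nv + 5 * (\<epsilon> * R)"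
        using env eR0 by (intro add_nonneg_nonneg) simp_all
      have "nv + R = Y" by (simp add: Y_def)
      then show "vnorm (\<beta> \<cdot>\<^sub>v v) + vnorm ((1 - \<beta>) \<cdot>\<^sub>v z) + \<epsilon> * nv + 5 * (\<epsilon> * R) \<le> 2 * Y"
        using zb vb eRY eY env eR0 Y0 by linarith
    qed
    then have "vnorm (fl_vadd M (fl_smult M \<beta> v) (fl_smult M (1 - \<beta>) z')
      - (\<beta> \<cdot>\<^sub>v v + (1 - \<beta>) \<cdot>\<^sub>v z)) \<le> \<epsilon> * nv + 5 * (\<epsilon> * R) + \<epsilon> * (2 * Y)"
      using vc zc by (intro fl_vadd_approx[OF bv bz _ _ err1 err2]) simp_all
    then show ?thesis using eRY env by linarith
  qed
  define G where "G = \<gamma> * R"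
  have G0: "0 \<le> G" using gamma_nonneg R0 by (simp add: G_def)
  have eG: "100 * (\<epsilon> * G) \<le> G" by (rule eps_mult_le[OF G0])
  have eG0: "0 \<le> \<epsilon> * G" using eps_pos G0 by simp
  have wg: "vnorm (\<gamma> \<cdot>\<^sub>v w) \<le> G"
    using mult_left_mono[OF w_le gamma_nonneg] gamma_nonneg by (simp add: G_def)
  have err4: "vnorm (fl_smult M \<gamma> w' - \<gamma> \<cdot>\<^sub>v w) \<le> 18 * (\<epsilon> * G)"
  proof -
    have "\<gamma> * (vnorm w + 16 * (\<epsilon> * R)) \<le> \<gamma> * (2 * R)"
      using w_le eR R0 gamma_nonneg by (intro mult_left_mono) auto
    then have "u * (\<gamma> * (vnorm w + 16 * (\<epsilon> * R))) \<le> \<epsilon> * (\<gamma> * (2 * R))"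
      using gamma_nonneg eps_pos R0 by (intro u_mult_le mult_nonneg_nonneg add_nonneg_nonneg) auto
    then have "vnorm (fl_smult M \<gamma> w' - \<gamma> \<cdot>\<^sub>v w) \<le> \<gamma> * (16 * (\<epsilon> * R)) + \<epsilon> * (\<gamma> * (2 * R))"
      using fl_smult_approx[OF w' gamma_rep wc werr] unfolding abs_of_nonneg[OF gamma_nonneg] by blast
    also have "\<dots> = 18 * (\<epsilon> * G)" by (simp add: G_def)
    finally show ?thesis .
  qed
  have gc: "\<gamma> \<cdot>\<^sub>v w \<in> carrier_vec n" using wc by simp
  have "vnorm (\<beta> \<cdot>\<^sub>v v + (1 - \<beta>) \<cdot>\<^sub>v z) \<le> Y"
    using vnorm_triangle[of "\<beta> \<cdot>\<^sub>v v" "(1 - \<beta>) \<cdot>\<^sub>v z"] vc zc zb vb by (simp add: Y_def)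
  then have "u * (vnorm (\<beta> \<cdot>\<^sub>v v + (1 - \<beta>) \<cdot>\<^sub>v z) + vnorm (\<gamma> \<cdot>\<^sub>v w) + 7 * (\<epsilon> * Y) + 18 * (\<epsilon> * G))
      \<le> \<epsilon> * (2 * Y + 2 * G)"
    using wg eY eG eY0 eG0 Y0 G0 vnorm_nonneg[of "\<beta> \<cdot>\<^sub>v v + (1 - \<beta>) \<cdot>\<^sub>v z"] vnorm_nonneg[of "\<gamma> \<cdot>\<^sub>v w"]
    by (intro u_mult_le) linarith+
  then have "vnorm (v' - (\<beta> \<cdot>\<^sub>v v + (1 - \<beta>) \<cdot>\<^sub>v z - \<gamma> \<cdot>\<^sub>v w))
      \<le> 7 * (\<epsilon> * Y) + 18 * (\<epsilon> * G) + \<epsilon> * (2 * Y + 2 * G)"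
    unfolding v'_eq by (rule fl_vsub_approx[OF h gw hc gc err3 err4])
  also have "\<dots> \<le> 20 * (\<epsilon> * (Y + G))"
    using eY0 eG0 by (simp add: algebra_simps)
  finally show "vnorm (v' - (\<beta> \<cdot>\<^sub>v v + (1 - \<beta>) \<cdot>\<^sub>v z - \<gamma> \<cdot>\<^sub>v w)) \<le> 20 * (\<epsilon> * (vnorm v + (1 + \<gamma>) * R))"
    by (simp add: Y_def G_def nv_def algebra_simps)
qed

end

section \<open>Expected accuracy of the computed ARK solution\<close>

text \<open>Every distribution in the algorithm has finite support, so expectations are finite sums and
  integrability never has to be tracked.\<close>

lemma expectation_bind_le:
  fixes h :: "'b \<Rightarrow> real" and g :: "'a \<Rightarrow> real"
  assumes fin: "finite (set_pmf p)" "\<And>a. a \<in> set_pmf p \<Longrightarrow> finite (set_pmf (f a))"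
    and le: "\<And>a. a \<in> set_pmf p \<Longrightarrow> measure_pmf.expectation (f a) h \<le> c * g a + d"
  shows "measure_pmf.expectation (bind_pmf p f) h \<le> c * measure_pmf.expectation p g + d"
proof -
  have "measure_pmf.expectation (bind_pmf p f) h
      = (\<Sum>a\<in>set_pmf p. pmf p a * measure_pmf.expectation (f a) h)"
    using fin by (subst pmf_expectation_bind[where A = "set_pmf p"]) auto
  also have "\<dots> \<le> (\<Sum>a\<in>set_pmf p. pmf p a * (c * g a + d))"
    by (intro sum_mono mult_left_mono le) auto
  also have "\<dots> = c * (\<Sum>a\<in>set_pmf p. g a * pmf p a) + d * (\<Sum>a\<in>set_pmf p. pmf p a)"
    by (simp add: sum.distrib sum_distrib_left algebra_simps)
  also have "(\<Sum>a\<in>set_pmf p. g a * pmf p a) = measure_pmf.expectation p g"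
    using fin by (subst integral_measure_pmf_real[of "set_pmf p"]) auto
  also have "(\<Sum>a\<in>set_pmf p. pmf p a) = 1"
    using fin by (intro sum_pmf_eq_1) auto
  finally show ?thesis by simp
qed

lemma expectation_le:
  fixes f g :: "'a \<Rightarrow> real"
  assumes fin: "finite (set_pmf p)"
    and le: "\<And>a. a \<in> set_pmf p \<Longrightarrow> f a \<le> c * g a + d"
  shows "measure_pmf.expectation p f \<le> c * measure_pmf.expectation p g + d"
  using expectation_bind_le[of p return_pmf f c g d] assms by (simp add: bind_return_pmf')

lemma sq_expectation_le:
  fixes f :: "'a \<Rightarrow> real"
  assumes fin: "finite (set_pmf p)"
  shows "(measure_pmf.expectation p f)\<^sup>2 \<le> measure_pmf.expectation p (\<lambda>a. (f a)\<^sup>2)"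
  using measure_pmf.variance_positive[of p f]
    measure_pmf.variance_eq[OF integrable_measure_pmf_finite[OF fin, of f]
      integrable_measure_pmf_finite[OF fin, of "\<lambda>a. (f a)\<^sup>2"]]
  by simp

lemma vnorm_sq_young:
  assumes "v \<in> carrier_vec n" "v' \<in> carrier_vec n" "0 < t"
  shows "(vnorm v')\<^sup>2 \<le> (1 + t) * (vnorm v)\<^sup>2 + (1 + 1 / t) * (vnorm (v' - v))\<^sup>2"
proof -
  define a b where "a = vnorm v" and "b = vnorm (v' - v)"
  have "vnorm v' \<le> a + b"
    using vnorm_le_add_dist[OF assms(2,1)] by (simp add: a_def b_def)
  then have "(vnorm v')\<^sup>2 \<le> (a + b)\<^sup>2" by (intro power_mono) auto
  also have "\<dots> = (1 + t) * a\<^sup>2 + (1 + 1 / t) * b\<^sup>2 - (t * a - b)\<^sup>2 / t"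
    using assms(3) by (simp add: power2_eq_square field_simps)
  also have "\<dots> \<le> (1 + t) * a\<^sup>2 + (1 + 1 / t) * b\<^sup>2"
    using assms(3) by simp
  finally show ?thesis by (simp add: a_def b_def)
qed

context ark_system
begin

text \<open>The Lyapunov function of ARK, rescaled by the strong convexity constant so that the error of
  the second component enters with weight one.\<close>

definition energy :: "real vec \<Rightarrow> real vec \<Rightarrow> real vec \<Rightarrow> real" where
  "energy x v y = \<sigma>\<^sup>2 * (vnorm (dual *\<^sub>v (v - x)))\<^sup>2 + (vnorm (y - x))\<^sup>2"

lemma energy_nonneg: "0 \<le> energy x v y"
  by (simp add: energy_def)

lemma vnorm_y_le_energy: "vnorm (y - x) \<le> sqrt (energy x v y)"
  by (rule real_le_rsqrt) (simp add: energy_def)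

lemma vnorm_v_le_energy:
  assumes "v \<in> carrier_vec n" "x \<in> carrier_vec n"
  shows "vnorm (v - x) \<le> \<kappa> * sqrt (energy x v y)"
proof -
  have "\<sigma> * vnorm (dual *\<^sub>v (v - x)) \<le> sqrt (energy x v y)"
    by (rule real_le_rsqrt) (simp add: energy_def power_mult_distrib)
  then have "F * (\<sigma> * vnorm (dual *\<^sub>v (v - x))) \<le> F * sqrt (energy x v y)"
    by (intro mult_left_mono) auto
  moreover have "\<sigma> * vnorm (v - x) \<le> \<sigma> * (F * vnorm (dual *\<^sub>v (v - x)))"
    using assms sigma_pos by (intro mult_left_mono vnorm_le_dual) auto
  ultimately have "\<sigma> * vnorm (v - x) \<le> F * sqrt (energy x v y)"
    by (simp only: mult.left_commute)
  then show ?thesis using sigma_pos by (simp add: kappa_eq field_simps)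
qed

lemma energy_start:
  assumes "x \<in> carrier_vec n"
  shows "energy x (0\<^sub>v n) (0\<^sub>v n) \<le> 2 * (vnorm x)\<^sup>2"
proof -
  have "(\<sigma> * vnorm (dual *\<^sub>v (0\<^sub>v n - x)))\<^sup>2 \<le> (vnorm x)\<^sup>2"
    using sigma_dual_le[of "0\<^sub>v n - x"] assms sigma_pos by (intro power_mono) auto
  then show ?thesis using assms by (simp add: energy_def power_mult_distrib)
qed

lemma energy_perturb:
  assumes "x \<in> carrier_vec n" "v \<in> carrier_vec n" "y \<in> carrier_vec n"
    "v' \<in> carrier_vec n" "y' \<in> carrier_vec n" and t: "0 < t"
  shows "energy x v' y'
    \<le> (1 + t) * energy x v y + (1 + 1 / t) * ((vnorm (v' - v))\<^sup>2 + (vnorm (y' - y))\<^sup>2)"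
proof -
  have "dual *\<^sub>v (v' - x) - dual *\<^sub>v (v - x) = dual *\<^sub>v ((v' - x) - (v - x))"
    using assms by (simp add: mult_minus_distrib_mat_vec[OF dual_carrier])
  also have "(v' - x) - (v - x) = v' - v" using assms by auto
  finally have dv: "dual *\<^sub>v (v' - x) - dual *\<^sub>v (v - x) = dual *\<^sub>v (v' - v)" .
  have dy: "(y' - x) - (y - x) = y' - y" using assms by auto
  have "\<sigma>\<^sup>2 * (vnorm (dual *\<^sub>v (v' - x)))\<^sup>2 \<le> \<sigma>\<^sup>2 * ((1 + t) * (vnorm (dual *\<^sub>v (v - x)))\<^sup>2
      + (1 + 1 / t) * (vnorm (dual *\<^sub>v (v' - v)))\<^sup>2)"
    using vnorm_sq_young[of "dual *\<^sub>v (v - x)" n "dual *\<^sub>v (v' - x)" t] assms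
    by (intro mult_left_mono) (simp_all add: dv)
  also have "\<dots> = (1 + t) * (\<sigma>\<^sup>2 * (vnorm (dual *\<^sub>v (v - x)))\<^sup>2)
      + (1 + 1 / t) * (\<sigma> * vnorm (dual *\<^sub>v (v' - v)))\<^sup>2"
    by (simp add: power_mult_distrib algebra_simps)
  also have "\<dots> \<le> (1 + t) * (\<sigma>\<^sup>2 * (vnorm (dual *\<^sub>v (v - x)))\<^sup>2) + (1 + 1 / t) * (vnorm (v' - v))\<^sup>2"
    using sigma_dual_le[of "v' - v"] assms sigma_pos t
    by (intro add_left_mono mult_left_mono power_mono) auto
  finally have 1: "\<sigma>\<^sup>2 * (vnorm (dual *\<^sub>v (v' - x)))\<^sup>2
      \<le> (1 + t) * (\<sigma>\<^sup>2 * (vnorm (dual *\<^sub>v (v - x)))\<^sup>2) + (1 + 1 / t) * (vnorm (v' - v))\<^sup>2" .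
  have 2: "(vnorm (y' - x))\<^sup>2 \<le> (1 + t) * (vnorm (y - x))\<^sup>2 + (1 + 1 / t) * (vnorm (y' - y))\<^sup>2"
    using vnorm_sq_young[of "y - x" n "y' - x" t] assms by (simp add: dy)
  show ?thesis
    using add_mono[OF 1 2] unfolding energy_def by (simp only: distrib_left add_ac)
qed

lemma energy_contraction:
  assumes x: "x \<in> carrier_vec n" and v: "v \<in> carrier_vec n" and y: "y \<in> carrier_vec n"
    and z_def: "z = \<alpha> \<cdot>\<^sub>v v + (1 - \<alpha>) \<cdot>\<^sub>v y"
    and w_def: "\<And>r. w r = ((row A r \<bullet> (z - x)) / denom r) \<cdot>\<^sub>v row A r"
  shows "(\<Sum>r<n. row_prob A lam r * energy x (\<beta> \<cdot>\<^sub>v v + (1 - \<beta>) \<cdot>\<^sub>v z - \<gamma> \<cdot>\<^sub>v w r) (z - w r))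
    \<le> (1 - rate) * energy x v y"
proof -
  have z: "z \<in> carrier_vec n" using v y by (simp add: z_def)
  define e where "e = z - x"
  define g where "g = \<beta> \<cdot>\<^sub>v v + (1 - \<beta>) \<cdot>\<^sub>v z - x"
  have e: "e = \<alpha> \<cdot>\<^sub>v (v - x) + (1 - \<alpha>) \<cdot>\<^sub>v (y - x)"
    using x v y by (auto simp: e_def z_def algebra_simps)
  have g: "g = \<beta> \<cdot>\<^sub>v (v - x) + (1 - \<beta>) \<cdot>\<^sub>v e"
    using x v y z by (auto simp: g_def e_def algebra_simps)
  have "energy x (\<beta> \<cdot>\<^sub>v v + (1 - \<beta>) \<cdot>\<^sub>v z - \<gamma> \<cdot>\<^sub>v w r) (z - w r)
      = \<sigma>\<^sup>2 * (vnorm (dual *\<^sub>v (g - (\<gamma> * ((row A r \<bullet> e) / denom r)) \<cdot>\<^sub>v row A r)))\<^sup>2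
        + (vnorm (e - ((row A r \<bullet> e) / denom r) \<cdot>\<^sub>v row A r))\<^sup>2" for r
  proof -
    have 1: "\<beta> \<cdot>\<^sub>v v + (1 - \<beta>) \<cdot>\<^sub>v z - \<gamma> \<cdot>\<^sub>v w r - x
        = g - (\<gamma> * ((row A r \<bullet> e) / denom r)) \<cdot>\<^sub>v row A r"
      using x v z by (auto simp: g_def w_def e_def algebra_simps)
    have 2: "z - w r - x = e - ((row A r \<bullet> e) / denom r) \<cdot>\<^sub>v row A r"
      using x z by (auto simp: w_def e_def algebra_simps)
    show ?thesis unfolding energy_def 1 2 ..
  qed
  then show ?thesis
    using error_contraction[OF _ _ e g] x v y by (simp add: energy_def)
qed

end

context fp_ark
begin

lemma set_row_pmf: "set_pmf (row_pmf A lam) \<subseteq> {..<n}"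
  using pmf_row_pmf[OF lam_nonneg T_pos] by (auto simp: set_pmf_iff row_prob_def split: if_splits)

lemma finite_set_row_pmf: "finite (set_pmf (row_pmf A lam))"
  using set_row_pmf finite_subset by blast

lemma expectation_row_pmf:
  "measure_pmf.expectation (row_pmf A lam) f = (\<Sum>r<n. row_prob A lam r * f r)" for f :: "nat \<Rightarrow> real"
  using set_row_pmf
  by (subst integral_measure_pmf_real[of "{..<n}"]) (auto simp: pmf_row_pmf[OF lam_nonneg T_pos] mult.commute)

lemma sum_row_prob: "(\<Sum>r<n. row_prob A lam r) = 1"
  using sum_denom T_pos by (simp add: row_prob_eq flip: sum_divide_distrib)

lemma row_prob_nonneg: "0 \<le> row_prob A lam r"
  using pmf_row_pmf[OF lam_nonneg T_pos, of r] pmf_nonneg[of "row_pmf A lam" r] by simp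

definition \<theta> where "\<theta> = 240000 * (\<epsilon> * \<kappa>)\<^sup>2 / rate"

lemma theta_le: "10000 * \<theta> \<le> rate / 4"
proof -
  have "(100000 * (\<epsilon> * \<kappa>))\<^sup>2 \<le> rate\<^sup>2"
    using eps_kappa_rate eps_pos kappa_ge_1 by (intro power_mono) auto
  then have "(\<epsilon> * \<kappa>)\<^sup>2 \<le> rate\<^sup>2 / 10000000000" by (simp add: power_mult_distrib)
  then have "2400000000 * (\<epsilon> * \<kappa>)\<^sup>2 / rate \<le> 2400000000 * (rate\<^sup>2 / 10000000000) / rate"
    using rate_pos by (intro divide_right_mono mult_left_mono) auto
  then have "10000 * \<theta> \<le> 2400000000 * (rate\<^sup>2 / 10000000000) / rate"
    by (simp add: \<theta>_def)
  then show ?thesis using rate_pos by (simp add: power2_eq_square)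
qed

lemma theta_nonneg: "0 \<le> \<theta>"
  using rate_pos by (simp add: \<theta>_def)

text \<open>The weight \<open>\<alpha>\<close> is at most \<open>1 / \<kappa>\<close>, which compensates the weaker control of \<open>v\<close> by the energy.\<close>

lemma mix_le_energy:
  assumes "x \<in> carrier_vec n" "v \<in> carrier_vec n" "y \<in> carrier_vec n"
  shows "\<alpha> * vnorm (v - x) + (1 - \<alpha>) * vnorm (y - x) \<le> 2 * sqrt (energy x v y)"
    and "\<alpha> * vnorm v + (1 - \<alpha>) * vnorm y \<le> vnorm x + 2 * sqrt (energy x v y)"
proof -
  define U where "U = sqrt (energy x v y)"
  have U0: "0 \<le> U" by (simp add: U_def energy_nonneg)
  have "\<alpha> * vnorm (v - x) \<le> \<alpha> * (\<kappa> * U)"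
    unfolding U_def by (intro mult_left_mono vnorm_v_le_energy assms alpha_nonneg)
  also have "\<dots> \<le> U"
    using mult_right_mono[OF alpha_kappa_le U0] by simp
  finally have 1: "\<alpha> * vnorm (v - x) \<le> U" .
  have "(1 - \<alpha>) * vnorm (y - x) \<le> 1 * U"
    unfolding U_def using alpha_nonneg alpha_le_1 by (intro mult_mono vnorm_y_le_energy) auto
  then have 2: "(1 - \<alpha>) * vnorm (y - x) \<le> U" by simp
  show "\<alpha> * vnorm (v - x) + (1 - \<alpha>) * vnorm (y - x) \<le> 2 * sqrt (energy x v y)"
    using 1 2 unfolding U_def by linarith
  have "\<alpha> * vnorm v + (1 - \<alpha>) * vnorm y
      \<le> \<alpha> * (vnorm x + vnorm (v - x)) + (1 - \<alpha>) * (vnorm x + vnorm (y - x))"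
    using assms alpha_nonneg alpha_le_1 by (intro add_mono mult_left_mono vnorm_le_add_dist) auto
  also have "\<dots> = vnorm x + (\<alpha> * vnorm (v - x) + (1 - \<alpha>) * vnorm (y - x))"
    by (simp add: algebra_simps)
  finally show "\<alpha> * vnorm v + (1 - \<alpha>) * vnorm y \<le> vnorm x + 2 * sqrt (energy x v y)"
    using 1 2 unfolding U_def by linarith
qed

text \<open>Young's inequality with parameter \<open>rate / 2\<close> separates the exact step, which loses at most half
  of its contraction, from the squared rounding error, which is amplified by \<open>3 / rate\<close>. That error is
  \<open>O((\<epsilon> \<kappa>)^2 (|x|^2 + energy))\<close>; since \<open>\<epsilon> \<kappa>\<close> is small against the rate, its energy part consumes at
  most another quarter of the contraction.\<close>

lemma fl_step_energy:
  assumes x: "x \<in> carrier_vec n" and c: "rep_vec M n (A *\<^sub>v x)"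
    and v: "rep_vec M n v" and y: "rep_vec M n y"
  shows "measure_pmf.expectation (row_pmf A lam)
      (\<lambda>r. case fl_ark_step M A (A *\<^sub>v x) lam \<mu> \<nu> r (v, y) of (v', y') \<Rightarrow> energy x v' y')
    \<le> (1 - rate / 4) * energy x v y + \<theta> * (vnorm x)\<^sup>2"
proof -
  define z where "z = \<alpha> \<cdot>\<^sub>v v + (1 - \<alpha>) \<cdot>\<^sub>v y"
  define w where "w r = ((row A r \<bullet> (z - x)) / denom r) \<cdot>\<^sub>v row A r" for r
  define R where "R = vnorm x + (\<alpha> * vnorm v + (1 - \<alpha>) * vnorm y)"
  define U where "U = sqrt (energy x v y)"
  define X where "X = vnorm x"
  have U0: "0 \<le> U" and U2: "U\<^sup>2 = energy x v y" by (simp_all add: U_def energy_nonneg)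
  have X0: "0 \<le> X" by (simp add: X_def)
  have vc: "v \<in> carrier_vec n" and yc: "y \<in> carrier_vec n" using v y by (auto dest: rep_vec_carrier)
  have zc: "z \<in> carrier_vec n" and wc: "w r \<in> carrier_vec n" for r
    using vc yc by (auto simp: z_def w_def)
  have R_le: "R \<le> 2 * (X + U)"
    using mix_le_energy(2)[OF x vc yc] unfolding R_def X_def U_def distrib_left by linarith
  have R0: "0 \<le> R" using alpha_nonneg alpha_le_1 by (simp add: R_def)
  have "vnorm v \<le> X + \<kappa> * U"
    using vnorm_le_add_dist[OF vc x] vnorm_v_le_energy[OF vc x, of y] unfolding X_def U_def by linarith
  moreover have "1 * X \<le> \<kappa> * X" using kappa_ge_1 X0 by (rule mult_right_mono)
  ultimately have v_le: "vnorm v \<le> \<kappa> * (X + U)" by (simp add: distrib_left)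
  have "(2 + \<gamma>) * R \<le> (4 * \<kappa>) * (2 * (X + U))"
    using gamma_le kappa_ge_1 R_le R0 gamma_nonneg by (intro mult_mono) linarith+
  also have "\<dots> = 8 * (\<kappa> * (X + U))" by (simp add: algebra_simps)
  finally have size: "vnorm v + (2 + \<gamma>) * R \<le> 9 * (\<kappa> * (X + U))" using v_le by linarith
  define D where "D = 200 * ((\<epsilon> * \<kappa>) * (X + U))"
  have D2: "D\<^sup>2 \<le> 80000 * (\<epsilon> * \<kappa>)\<^sup>2 * (X\<^sup>2 + U\<^sup>2)"
  proof -
    have "(X + U)\<^sup>2 \<le> 2 * (X\<^sup>2 + U\<^sup>2)"
      using zero_le_power2[of "X - U"] by (simp add: power2_eq_square algebra_simps)
    moreover have "D\<^sup>2 = 40000 * (\<epsilon> * \<kappa>)\<^sup>2 * (X + U)\<^sup>2"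
      by (simp add: D_def power_mult_distrib)
    ultimately have "D\<^sup>2 \<le> 40000 * (\<epsilon> * \<kappa>)\<^sup>2 * (2 * (X\<^sup>2 + U\<^sup>2))"
      by (simp only:) (intro mult_left_mono, auto)
    also have "\<dots> = 80000 * (\<epsilon> * \<kappa>)\<^sup>2 * (X\<^sup>2 + U\<^sup>2)" by (simp add: algebra_simps)
    finally show ?thesis .
  qed
  let ?v = "\<lambda>r. \<beta> \<cdot>\<^sub>v v + (1 - \<beta>) \<cdot>\<^sub>v z - \<gamma> \<cdot>\<^sub>v w r" and ?y = "\<lambda>r. z - w r"
  let ?t = "rate / 2"
  have t: "0 < ?t" "1 + 1 / ?t \<le> 3 / rate" using rate_pos rate_le_1 by (simp_all add: field_simps)
  have step: "(case fl_ark_step M A (A *\<^sub>v x) lam \<mu> \<nu> r (v, y) of (v', y') \<Rightarrow> energy x v' y')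
      \<le> (1 + ?t) * energy x (?v r) (?y r) + \<theta> * (X\<^sup>2 + U\<^sup>2)" if r: "r < n" for r
  proof -
    obtain v' y' where s: "fl_ark_step M A (A *\<^sub>v x) lam \<mu> \<nu> r (v, y) = (v', y')" by force
    note E = fl_ark_step_err[OF r x c v y z_def w_def R_def s]
    define dv dy where "dv = vnorm (v' - ?v r)" and "dy = vnorm (y' - ?y r)"
    have "dy + dv \<le> 22 * (\<epsilon> * R) + 22 * (\<epsilon> * (vnorm v + (1 + \<gamma>) * R))"
    proof -
      have "0 \<le> \<epsilon> * (vnorm v + (1 + \<gamma>) * R)"
        using eps_pos R0 gamma_nonneg by simp
      then show ?thesis using E(3,4) unfolding dv_def dy_def by linarith
    qed
    also have "\<dots> = 22 * (\<epsilon> * (vnorm v + (2 + \<gamma>) * R))" by (simp add: algebra_simps)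
    also have "\<dots> \<le> 22 * (\<epsilon> * (9 * (\<kappa> * (X + U))))"
      using size eps_pos by (intro mult_left_mono) auto
    also have "\<dots> \<le> D"
      using mult_nonneg_nonneg[of "\<epsilon> * \<kappa>" "X + U"] eps_pos kappa_ge_1 X0 U0
      by (simp add: D_def mult_ac)
    finally have "dy + dv \<le> D" .
    then have "(dy + dv)\<^sup>2 \<le> D\<^sup>2" by (intro power_mono) (auto simp: dv_def dy_def)
    moreover have "dv\<^sup>2 + dy\<^sup>2 \<le> (dy + dv)\<^sup>2"
      by (simp add: power2_eq_square algebra_simps dv_def dy_def)
    ultimately have "dv\<^sup>2 + dy\<^sup>2 \<le> 80000 * (\<epsilon> * \<kappa>)\<^sup>2 * (X\<^sup>2 + U\<^sup>2)" using D2 by linarith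
    then have "(1 + 1 / ?t) * (dv\<^sup>2 + dy\<^sup>2) \<le> 3 / rate * (80000 * (\<epsilon> * \<kappa>)\<^sup>2 * (X\<^sup>2 + U\<^sup>2))"
      using t rate_pos by (intro mult_mono) auto
    also have "\<dots> = \<theta> * (X\<^sup>2 + U\<^sup>2)" by (simp add: \<theta>_def)
    finally have "(1 + 1 / ?t) * (dv\<^sup>2 + dy\<^sup>2) \<le> \<theta> * (X\<^sup>2 + U\<^sup>2)" .
    moreover have "energy x v' y' \<le> (1 + ?t) * energy x (?v r) (?y r) + (1 + 1 / ?t) * (dv\<^sup>2 + dy\<^sup>2)"
      unfolding dv_def dy_def
      using E(1,2)[THEN rep_vec_carrier] x vc zc wc t(1) by (intro energy_perturb) auto
    ultimately show ?thesis by (simp add: s)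
  qed
  have "measure_pmf.expectation (row_pmf A lam)
      (\<lambda>r. case fl_ark_step M A (A *\<^sub>v x) lam \<mu> \<nu> r (v, y) of (v', y') \<Rightarrow> energy x v' y')
    \<le> (\<Sum>r<n. row_prob A lam r * ((1 + ?t) * energy x (?v r) (?y r) + \<theta> * (X\<^sup>2 + U\<^sup>2)))"
    unfolding expectation_row_pmf using step row_prob_nonneg by (intro sum_mono mult_left_mono) auto
  also have "\<dots> = (1 + ?t) * (\<Sum>r<n. row_prob A lam r * energy x (?v r) (?y r))
      + \<theta> * (X\<^sup>2 + U\<^sup>2) * (\<Sum>r<n. row_prob A lam r)"
    unfolding sum_distrib_left sum.distrib[symmetric] by (rule sum.cong) (simp_all add: algebra_simps)
  also have "\<dots> \<le> (1 + ?t) * ((1 - rate) * U\<^sup>2) + \<theta> * (X\<^sup>2 + U\<^sup>2)"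
    unfolding sum_row_prob U2 using energy_contraction[OF x vc yc z_def w_def] t(1)
    by (simp add: mult_left_mono)
  also have "\<dots> \<le> (1 - rate / 4) * U\<^sup>2 + \<theta> * X\<^sup>2"
  proof -
    have "(1 + ?t) * (1 - rate) = 1 - rate / 2 - rate\<^sup>2 / 2"
      by (simp add: power2_eq_square field_simps)
    then have "(1 + ?t) * (1 - rate) + \<theta> \<le> 1 - rate / 4"
      using theta_le theta_nonneg zero_le_power2[of rate] by linarith
    then have "((1 + ?t) * (1 - rate) + \<theta>) * U\<^sup>2 \<le> (1 - rate / 4) * U\<^sup>2"
      by (rule mult_right_mono) simp
    moreover have "(1 + t') * ((1 - rate) * U\<^sup>2) + \<theta> * (X\<^sup>2 + U\<^sup>2)
        = ((1 + t') * (1 - rate) + \<theta>) * U\<^sup>2 + \<theta> * X\<^sup>2" for t'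
      by (simp add: algebra_simps)
    ultimately show ?thesis by (simp only: add_right_mono)
  qed
  finally show ?thesis by (simp add: U2 X_def)
qed

lemma set_fl_ark_state:
  assumes c: "rep_vec M n c"
  shows "finite (set_pmf (fl_ark_state M A c lam \<mu> \<nu> k)) \<and>
    (\<forall>(v, y)\<in>set_pmf (fl_ark_state M A c lam \<mu> \<nu> k). rep_vec M n v \<and> rep_vec M n y)"
proof (induction k)
  case 0
  then show ?case by (simp add: rep_vec_zero)
next
  case (Suc k)
  define x where "x = inv_mat A *\<^sub>v c"
  have cc: "c \<in> carrier_vec n" using c by (rule rep_vec_carrier)
  have x: "x \<in> carrier_vec n" and Ax: "A *\<^sub>v x = c"
    using cc by (simp_all add: x_def A_inv_vec)
  have "rep_vec M n v' \<and> rep_vec M n y'"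
    if "(v, y) \<in> set_pmf (fl_ark_state M A c lam \<mu> \<nu> k)" "r \<in> set_pmf (row_pmf A lam)"
      "(v', y') = fl_ark_step M A c lam \<mu> \<nu> r (v, y)" for v y r v' y'
  proof -
    have "r < n" "rep_vec M n v" "rep_vec M n y" using that Suc set_row_pmf by auto
    then show ?thesis
      using fl_ark_step_err(1,2)[of r x v y _ _ _ v' y', OF _ x _ _ _ refl refl refl] c that(3)
      by (simp add: Ax)
  qed
  then show ?case
    using Suc finite_set_row_pmf by (fastforce simp: set_bind_pmf)
qed

text \<open>The term \<open>4 \<theta> / rate\<close> is the fixed point of the recursion \<open>E \<mapsto> (1 - rate / 4) E + \<theta>\<close>, that is, the
  limiting accuracy of a single run.\<close>

lemma fl_ark_state_energy:
  assumes x: "x \<in> carrier_vec n" and c: "rep_vec M n (A *\<^sub>v x)"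
  shows "measure_pmf.expectation (fl_ark_state M A (A *\<^sub>v x) lam \<mu> \<nu> k) (\<lambda>(v, y). energy x v y)
    \<le> ((1 - rate / 4) ^ k * 2 + 4 * \<theta> / rate) * (vnorm x)\<^sup>2"
proof (induction k)
  case 0
  have "0 \<le> 4 * \<theta> / rate * (vnorm x)\<^sup>2" using theta_nonneg rate_pos by simp
  then show ?case using energy_start[OF x] by (simp add: distrib_right)
next
  case (Suc k)
  let ?S = "fl_ark_state M A (A *\<^sub>v x) lam \<mu> \<nu>"
  note F = set_fl_ark_state[OF c, of k]
  have "measure_pmf.expectation (?S (Suc k)) (\<lambda>(v, y). energy x v y)
      \<le> (1 - rate / 4) * measure_pmf.expectation (?S k) (\<lambda>(v, y). energy x v y) + \<theta> * (vnorm x)\<^sup>2"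
    unfolding fl_ark_state.simps
  proof (rule expectation_bind_le)
    fix s assume s: "s \<in> set_pmf (?S k)"
    obtain v y where vy: "s = (v, y)" by force
    then show "measure_pmf.expectation
        (map_pmf (\<lambda>r. fl_ark_step M A (A *\<^sub>v x) lam \<mu> \<nu> r s) (row_pmf A lam)) (\<lambda>(v, y). energy x v y)
        \<le> (1 - rate / 4) * (case s of (v, y) \<Rightarrow> energy x v y) + \<theta> * (vnorm x)\<^sup>2"
      using fl_step_energy[OF x c, of v y] F s by (auto simp: case_prod_beta)
  qed (use F finite_set_row_pmf in auto)
  also have "\<dots> \<le> (1 - rate / 4) * (((1 - rate / 4) ^ k * 2 + 4 * \<theta> / rate) * (vnorm x)\<^sup>2)
      + \<theta> * (vnorm x)\<^sup>2"
    using rate_le_1 by (intro add_right_mono mult_left_mono Suc) auto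
  also have "\<dots> = ((1 - rate / 4) ^ Suc k * 2 + 4 * \<theta> / rate) * (vnorm x)\<^sup>2"
    using rate_pos by (simp add: field_simps)
  finally show ?case .
qed

text \<open>Forty times the reciprocal of the rate is enough, because \<open>(1 - rate / 4)^K\<close> is then at most
  \<open>exp (-10)\<close> and the expected energy at most \<open>|x|^2 / 256\<close>. The output inherits the bound by Jensen's
  inequality: \<open>v\<close> may be \<open>\<kappa>\<close> times less accurate than \<open>y\<close>, but its weight \<open>\<alpha>\<close> in \<open>z\<close> is at most
  \<open>1 / \<kappa>\<close>.\<close>

lemma
  assumes x: "x \<in> carrier_vec n" and c: "rep_vec M n (A *\<^sub>v x)" and K: "40 \<le> real K * rate"
  shows finite_fl_solver: "finite (set_pmf (fl_solver M A lam \<mu> \<nu> K (A *\<^sub>v x)))"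
    and fl_solver_rep: "d \<in> set_pmf (fl_solver M A lam \<mu> \<nu> K (A *\<^sub>v x)) \<Longrightarrow> rep_vec M n d"
    and fl_solver_err: "measure_pmf.expectation (fl_solver M A lam \<mu> \<nu> K (A *\<^sub>v x))
      (\<lambda>d. vnorm (d - x)) \<le> vnorm x / 4"
proof -
  let ?S = "fl_ark_state M A (A *\<^sub>v x) lam \<mu> \<nu> K"
  note F = set_fl_ark_state[OF c, of K]
  show "finite (set_pmf (fl_solver M A lam \<mu> \<nu> K (A *\<^sub>v x)))"
    using F by (simp add: fl_solver_def)
  show "d \<in> set_pmf (fl_solver M A lam \<mu> \<nu> K (A *\<^sub>v x)) \<Longrightarrow> rep_vec M n d"
    using F fl_ark_z_rep by (fastforce simp: fl_solver_def)
  define U where "U = (\<lambda>(v, y). sqrt (energy x v y))"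
  have "(1 - rate / 4) ^ K \<le> exp (- rate / 4) ^ K"
    using exp_ge_add_one_self[of "- rate / 4"] rate_le_1 by (intro power_mono) auto
  also have "\<dots> = exp (- (real K * rate / 4))" by (simp flip: exp_of_nat_mult)
  also have "\<dots> \<le> exp (- 10)" using K by simp
  also have "exp (- 10 :: real) = 1 / exp 1 ^ 10" by (simp add: exp_minus field_simps flip: exp_of_nat_mult)
  also have "\<dots> \<le> 1 / 2 ^ 10"
    using exp_ge_add_one_self[of "1::real"] by (intro divide_left_mono power_mono) auto
  finally have pow: "(1 - rate / 4) ^ K \<le> 1 / 1024" by simp
  have "4 * \<theta> / rate \<le> 1 / 10000" using theta_le rate_pos by (simp add: field_simps)
  with pow have "(1 - rate / 4) ^ K * 2 + 4 * \<theta> / rate \<le> 1 / 256" by linarith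
  then have "((1 - rate / 4) ^ K * 2 + 4 * \<theta> / rate) * (vnorm x)\<^sup>2 \<le> 1 / 256 * (vnorm x)\<^sup>2"
    by (rule mult_right_mono) simp
  then have "measure_pmf.expectation ?S (\<lambda>(v, y). energy x v y) \<le> 1 / 256 * (vnorm x)\<^sup>2"
    using fl_ark_state_energy[OF x c, of K] by linarith
  moreover have "(\<lambda>s. (U s)\<^sup>2) = (\<lambda>(v, y). energy x v y)"
    by (auto simp: U_def energy_nonneg)
  ultimately have "(measure_pmf.expectation ?S U)\<^sup>2 \<le> (vnorm x / 16)\<^sup>2"
    using sq_expectation_le[of ?S U] F by (simp add: power_divide)
  then have EU: "measure_pmf.expectation ?S U \<le> vnorm x / 16"
    by (rule power2_le_imp_le) simp
  have "measure_pmf.expectation ?S (\<lambda>s. vnorm (fl_ark_z M \<mu> \<nu> s - x))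
      \<le> 3 * measure_pmf.expectation ?S U + vnorm x / 100"
  proof (rule expectation_le)
    fix s assume s: "s \<in> set_pmf ?S"
    obtain v y where vy: "s = (v, y)" by force
    have v: "rep_vec M n v" and y: "rep_vec M n y" using F s vy by auto
    have vc: "v \<in> carrier_vec n" and yc: "y \<in> carrier_vec n" using v y by (auto dest: rep_vec_carrier)
    let ?z = "\<alpha> \<cdot>\<^sub>v v + (1 - \<alpha>) \<cdot>\<^sub>v y"
    have "?z - x = \<alpha> \<cdot>\<^sub>v (v - x) + (1 - \<alpha>) \<cdot>\<^sub>v (y - x)"
      using x vc yc by (auto simp: algebra_simps)
    then have 1: "vnorm (?z - x) \<le> \<alpha> * vnorm (v - x) + (1 - \<alpha>) * vnorm (y - x)"
      using vnorm_triangle[of "\<alpha> \<cdot>\<^sub>v (v - x)" "(1 - \<alpha>) \<cdot>\<^sub>v (y - x)"] x alpha_nonneg alpha_le_1 by simp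
    have Us: "U s = sqrt (energy x v y)" by (simp add: U_def vy)
    have U0: "0 \<le> U s" by (simp add: Us energy_nonneg)
    have eU: "100 * (\<epsilon> * U s) \<le> U s" by (rule eps_mult_le[OF U0])
    have eX: "1000000 * (\<epsilon> * vnorm x) \<le> vnorm x"
      using mult_right_mono[OF eps_small, of "vnorm x"] by simp
    have "\<epsilon> * (\<alpha> * vnorm v + (1 - \<alpha>) * vnorm y) \<le> \<epsilon> * (vnorm x + 2 * U s)"
      using mix_le_energy(2)[OF x vc yc] eps_pos by (simp add: Us)
    then have "vnorm (fl_ark_z M \<mu> \<nu> s - ?z) \<le> 3 * (\<epsilon> * vnorm x) + 6 * (\<epsilon> * U s)"
      using fl_ark_z_err[OF v y] by (simp add: vy distrib_left)
    then have "vnorm (fl_ark_z M \<mu> \<nu> s - ?z) \<le> vnorm x / 100 + U s"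
      using eU eX U0 vnorm_nonneg[of x] by linarith
    then show "vnorm (fl_ark_z M \<mu> \<nu> s - x) \<le> 3 * U s + vnorm x / 100"
      using 1 mix_le_energy(1)[OF x vc yc] Us vc yc x rep_vec_carrier[OF fl_ark_z_rep[OF v y]]
        vnorm_dist_triangle[of "fl_ark_z M \<mu> \<nu> s" n ?z x] by (simp add: vy)
  qed (use F in simp)
  then show "measure_pmf.expectation (fl_solver M A lam \<mu> \<nu> K (A *\<^sub>v x)) (\<lambda>d. vnorm (d - x)) \<le> vnorm x / 4"
    using EU vnorm_nonneg[of x] unfolding fl_solver_def integral_map_pmf by linarith
qed

end

section \<open>Iterative refinement\<close>

context fp_ark
begin

text \<open>The residual is computed in the working precision, so its error is \<open>O(\<epsilon> F (|x| + |xi - x|))\<close>, however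
  small the residual itself is. Applying the inverse divides this by at most \<open>\<sigma>\<close>, and \<open>F / \<sigma> = \<kappa>\<close>. This is
  the floor on the attainable accuracy.\<close>

lemma fl_residual_err:
  assumes x: "x \<in> carrier_vec n" and b: "rep_vec M n (A *\<^sub>v x)" and xi: "rep_vec M n xi"
    and res_def: "res = fl_vsub M (A *\<^sub>v x) (fl_matvec M A xi)"
  shows "rep_vec M n res"
    and "vnorm (inv_mat A *\<^sub>v res - (x - xi)) \<le> 5 * (\<epsilon> * \<kappa>) * (vnorm x + vnorm (xi - x))"
proof -
  have nu: "real n * u \<le> 1" using eps_small eps_pos unfolding \<epsilon>_def[symmetric] by linarith
  have xic: "xi \<in> carrier_vec n" using xi by (rule rep_vec_carrier)
  have mv: "rep_vec M n (fl_matvec M A xi)"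
    and mv_err: "vnorm (fl_matvec M A xi - A *\<^sub>v xi) \<le> 2 * (\<epsilon> * (F * vnorm xi))"
    using fl_matvec_rep[OF A_carrier row_rep xi dim_pos nu] fl_matvec_err[OF A_carrier row_rep xi dim_pos nu]
    by (simp_all add: \<epsilon>_def mult_ac)
  show res: "rep_vec M n res" unfolding res_def by (rule fl_vsub_rep[OF b mv])
  define X E where "X = F * vnorm x" and "E = F * vnorm (xi - x)"
  have X0: "0 \<le> X" and E0: "0 \<le> E" by (simp_all add: X_def E_def)
  have Xi: "F * vnorm xi \<le> X + E"
    using mult_left_mono[OF vnorm_le_add_dist[OF xic x] frob_norm_nonneg[of A]]
    by (simp add: X_def E_def distrib_left)
  define S where "S = X + E"
  have S0: "0 \<le> S" using X0 E0 by (simp add: S_def)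
  have eS: "100 * (\<epsilon> * S) \<le> S" by (rule eps_mult_le[OF S0])
  have mv_err': "vnorm (fl_matvec M A xi - A *\<^sub>v xi) \<le> 2 * (\<epsilon> * S)"
    using mv_err mult_left_mono[OF Xi less_imp_le[OF eps_pos]] unfolding S_def by linarith
  have "A *\<^sub>v x - fl_matvec M A xi = (A *\<^sub>v x - A *\<^sub>v xi) - (fl_matvec M A xi - A *\<^sub>v xi)"
    using rep_vec_carrier[OF mv] by auto
  then have res_size: "vnorm (A *\<^sub>v x - fl_matvec M A xi) \<le> E + 2 * (\<epsilon> * S)"
  proof -
    assume eq: "A *\<^sub>v x - fl_matvec M A xi = (A *\<^sub>v x - A *\<^sub>v xi) - (fl_matvec M A xi - A *\<^sub>v xi)"
    have "A *\<^sub>v x - A *\<^sub>v xi = A *\<^sub>v (x - xi)"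
      using x xic by (simp add: mult_minus_distrib_mat_vec[OF A_carrier])
    then have "vnorm (A *\<^sub>v x - A *\<^sub>v xi) \<le> E"
      using vnorm_mult_mat_vec_le_frob[of "x - xi" A] x xic vnorm_minus_commute[of x xi]
      by (simp add: E_def)
    then show ?thesis
      using vnorm_triangle_minus[of "A *\<^sub>v x - A *\<^sub>v xi" "fl_matvec M A xi - A *\<^sub>v xi"] mv_err'
      unfolding eq by simp
  qed
  have "u * vnorm (A *\<^sub>v x - fl_matvec M A xi) \<le> \<epsilon> * (3 * S)"
  proof (rule u_mult_le)
    have "E \<le> S" using X0 by (simp add: S_def)
    then show "vnorm (A *\<^sub>v x - fl_matvec M A xi) \<le> 3 * S" using res_size eS S0 by linarith
  qed simp
  then have 1: "vnorm (res - (A *\<^sub>v x - fl_matvec M A xi)) \<le> 3 * (\<epsilon> * S)"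
    using fl_vsub_err[OF b mv] by (simp add: res_def)
  have "(A *\<^sub>v x - fl_matvec M A xi) - A *\<^sub>v (x - xi) = - (fl_matvec M A xi - A *\<^sub>v xi)"
    using x xic rep_vec_carrier[OF mv] by (auto simp: mult_minus_distrib_mat_vec[OF A_carrier])
  then have 2: "vnorm ((A *\<^sub>v x - fl_matvec M A xi) - A *\<^sub>v (x - xi)) \<le> 2 * (\<epsilon> * S)"
    using mv_err' by simp
  have resc: "res \<in> carrier_vec n" using res by (rule rep_vec_carrier)
  have tot: "vnorm (res - A *\<^sub>v (x - xi)) \<le> 5 * (\<epsilon> * S)"
    using vnorm_dist_triangle[of res n "A *\<^sub>v x - fl_matvec M A xi" "A *\<^sub>v (x - xi)"] 1 2
      resc x xic rep_vec_carrier[OF mv] by simp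
  have "inv_mat A *\<^sub>v (res - A *\<^sub>v (x - xi)) = inv_mat A *\<^sub>v res - (x - xi)"
    using resc x xic by (simp add: mult_minus_distrib_mat_vec[OF inv_carrier] inv_A_vec)
  then have "\<sigma> * vnorm (inv_mat A *\<^sub>v res - (x - xi)) \<le> 5 * (\<epsilon> * S)"
    using inv_mult_le[of "res - A *\<^sub>v (x - xi)"] tot resc x xic by simp
  then have "vnorm (inv_mat A *\<^sub>v res - (x - xi)) \<le> 5 * (\<epsilon> * S) / \<sigma>"
    using sigma_pos by (simp add: field_simps)
  also have "\<dots> = 5 * (\<epsilon> * \<kappa>) * (vnorm x + vnorm (xi - x))"
    by (simp add: S_def X_def E_def kappa_eq field_simps)
  finally show "vnorm (inv_mat A *\<^sub>v res - (x - xi)) \<le> 5 * (\<epsilon> * \<kappa>) * (vnorm x + vnorm (xi - x))" .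
qed

text \<open>The solver reduces the error of the correction to a quarter of its size, which leaves room for the
  errors of the residual and of the final addition below the factor one half.\<close>

lemma fl_refine_step:
  assumes x: "x \<in> carrier_vec n" and b: "rep_vec M n (A *\<^sub>v x)" and xi: "rep_vec M n xi"
    and K: "40 \<le> real K * rate"
    and step_def: "step = map_pmf (fl_vadd M xi)
      (fl_solver M A lam \<mu> \<nu> K (fl_vsub M (A *\<^sub>v x) (fl_matvec M A xi)))"
  shows "finite (set_pmf step)" and "x' \<in> set_pmf step \<Longrightarrow> rep_vec M n x'"
    and "measure_pmf.expectation step (\<lambda>x'. vnorm (x' - x))
      \<le> 1 / 2 * vnorm (xi - x) + 10 * (\<epsilon> * \<kappa>) * vnorm x"
proof -
  define res where "res = fl_vsub M (A *\<^sub>v x) (fl_matvec M A xi)"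
  define y where "y = inv_mat A *\<^sub>v res"
  note R = fl_residual_err[OF x b xi res_def]
  have xic: "xi \<in> carrier_vec n" using xi by (rule rep_vec_carrier)
  have resc: "res \<in> carrier_vec n" using R(1) by (rule rep_vec_carrier)
  have y: "y \<in> carrier_vec n" and Ay: "A *\<^sub>v y = res"
    using resc by (simp_all add: y_def A_inv_vec)
  have Ayr: "rep_vec M n (A *\<^sub>v y)" using R(1) Ay by simp
  note S = finite_fl_solver[OF y Ayr K] fl_solver_rep[OF y Ayr K] fl_solver_err[OF y Ayr K]
  have step: "step = map_pmf (fl_vadd M xi) (fl_solver M A lam \<mu> \<nu> K (A *\<^sub>v y))"
    by (simp add: step_def Ay res_def)
  show "finite (set_pmf step)" using S(1) by (simp add: step)
  show "x' \<in> set_pmf step \<Longrightarrow> rep_vec M n x'"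
    using S(2) by (auto simp: step intro: fl_vadd_rep[OF xi])
  define X where "X = vnorm x"
  define E where "E = vnorm (xi - x)"
  define \<omega> where "\<omega> = 5 * (\<epsilon> * \<kappa>)"
  define B where "B = vnorm (y - (x - xi))"
  have B: "B \<le> \<omega> * (X + E)" using R(2) by (simp add: B_def y_def \<omega>_def X_def E_def)
  have om: "0 \<le> \<omega>" "100 * \<omega> \<le> 1" "u \<le> \<omega> / 5"
  proof -
    have ek: "0 \<le> \<epsilon> * \<kappa>" using eps_pos kappa_ge_1 by simp
    then show "0 \<le> \<omega>" "100 * \<omega> \<le> 1" using eps_kappa_small unfolding \<omega>_def by linarith+
    have "\<epsilon> * 1 \<le> \<epsilon> * \<kappa>" using eps_pos kappa_ge_1 by (intro mult_left_mono) auto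
    then show "u \<le> \<omega> / 5" using u_le_eps unfolding \<omega>_def by linarith
  qed
  have X0: "0 \<le> X" and E0: "0 \<le> E" by (simp_all add: X_def E_def)
  have u_small: "100 * u \<le> 1" using om by linarith
  have y_le: "vnorm y \<le> E + B"
    using vnorm_le_add_dist[of y n "x - xi"] y x xic vnorm_minus_commute[of x xi]
    by (simp add: B_def E_def)
  have "measure_pmf.expectation (fl_solver M A lam \<mu> \<nu> K (A *\<^sub>v y)) (\<lambda>d. vnorm (fl_vadd M xi d - x))
      \<le> (1 + u) * measure_pmf.expectation (fl_solver M A lam \<mu> \<nu> K (A *\<^sub>v y)) (\<lambda>d. vnorm (d - y))
        + ((1 + u) * B + u * X)"
  proof (rule expectation_le[OF S(1)])
    fix d assume "d \<in> set_pmf (fl_solver M A lam \<mu> \<nu> K (A *\<^sub>v y))"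
    then have d: "rep_vec M n d" by (rule S(2))
    have dc: "d \<in> carrier_vec n" using d by (rule rep_vec_carrier)
    have s: "fl_vadd M xi d \<in> carrier_vec n" using fl_vadd_rep[OF xi d] by (rule rep_vec_carrier)
    have "xi + d - x = (d - y) + (y - (x - xi))" using xic dc x y by auto
    then have 1: "vnorm (xi + d - x) \<le> vnorm (d - y) + B"
      using vnorm_triangle[of "d - y" "y - (x - xi)"] x xic y by (simp add: B_def)
    have "vnorm (xi + d) \<le> X + (vnorm (d - y) + B)"
      using vnorm_le_add_dist[of "xi + d" n x] xic dc x 1 by (simp add: X_def)
    then have "u * vnorm (xi + d) \<le> u * (X + (vnorm (d - y) + B))"
      using u_pos by (intro mult_left_mono) auto
    then have "vnorm (fl_vadd M xi d - (xi + d)) \<le> u * X + (u * vnorm (d - y) + u * B)"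
      using fl_vadd_err[OF xi d] unfolding distrib_left by linarith
    then show "vnorm (fl_vadd M xi d - x) \<le> (1 + u) * vnorm (d - y) + ((1 + u) * B + u * X)"
      using vnorm_dist_triangle[of "fl_vadd M xi d" n "xi + d" x] s xic dc x 1
      unfolding distrib_right mult_1 by simp
  qed
  also have "\<dots> \<le> (1 + u) * ((E + B) / 4) + ((1 + u) * B + u * X)"
    using S(3) y_le u_pos by (intro add_right_mono mult_left_mono) auto
  also have "\<dots> = (1 + u) / 4 * E + 5 * (1 + u) / 4 * B + u * X"
    by (simp add: field_simps)
  also have "\<dots> \<le> 101 / 400 * E + 13 / 10 * (\<omega> * (X + E)) + \<omega> / 5 * X"
    using u_small om B E0 X0 by (intro add_mono mult_mono) (auto simp: B_def)
  also have "\<dots> \<le> 1 / 2 * E + 2 * \<omega> * X"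
  proof -
    have "\<omega> * E \<le> 1 / 100 * E" using om E0 by (intro mult_right_mono) auto
    moreover have "0 \<le> \<omega> * X" using om X0 by simp
    moreover have "\<omega> / 5 * X = 1 / 5 * (\<omega> * X)" "2 * \<omega> * X = 2 * (\<omega> * X)" by simp_all
    ultimately show ?thesis using E0 unfolding distrib_left by linarith
  qed
  finally show "measure_pmf.expectation step (\<lambda>x'. vnorm (x' - x))
      \<le> 1 / 2 * vnorm (xi - x) + 10 * (\<epsilon> * \<kappa>) * vnorm x"
    by (simp add: step E_def X_def \<omega>_def)
qed

lemma set_fl_refine:
  assumes x: "x \<in> carrier_vec n" and b: "rep_vec M n (A *\<^sub>v x)" and K: "40 \<le> real K * rate"
  shows "finite (set_pmf (fl_refine M A lam \<mu> \<nu> K (A *\<^sub>v x) i)) \<and>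
    (\<forall>xi\<in>set_pmf (fl_refine M A lam \<mu> \<nu> K (A *\<^sub>v x) i). rep_vec M n xi)"
proof (induction i)
  case 0
  show ?case using finite_fl_solver[OF x b K] fl_solver_rep[OF x b K] by simp
next
  case (Suc i)
  then show ?case
    using fl_refine_step(1,2)[OF x b _ K refl] by (auto simp: set_bind_pmf)
qed

lemma fl_refine_err:
  assumes x: "x \<in> carrier_vec n" and b: "rep_vec M n (A *\<^sub>v x)" and K: "40 \<le> real K * rate"
  shows "measure_pmf.expectation (fl_refine M A lam \<mu> \<nu> K (A *\<^sub>v x) i) (\<lambda>xi. vnorm (xi - x))
    \<le> ((1 / 2) ^ i + 20 * (\<epsilon> * \<kappa>)) * vnorm x"
proof (induction i)
  case 0
  have "vnorm x / 4 \<le> (1 + 20 * (\<epsilon> * \<kappa>)) * vnorm x"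
    using eps_pos kappa_ge_1 mult_right_mono[of "1 / 4" "1 + 20 * (\<epsilon> * \<kappa>)" "vnorm x"]
    by (simp add: add_increasing2)
  then show ?case using fl_solver_err[OF x b K] by simp
next
  case (Suc i)
  let ?S = "fl_refine M A lam \<mu> \<nu> K (A *\<^sub>v x)"
  note F = set_fl_refine[OF x b K, of i]
  have "measure_pmf.expectation (?S (Suc i)) (\<lambda>xi. vnorm (xi - x))
      \<le> 1 / 2 * measure_pmf.expectation (?S i) (\<lambda>xi. vnorm (xi - x)) + 10 * (\<epsilon> * \<kappa>) * vnorm x"
    unfolding fl_refine.simps
    by (rule expectation_bind_le; use F fl_refine_step(1,3)[OF x b _ K refl] in blast)
  also have "\<dots> \<le> 1 / 2 * (((1 / 2) ^ i + 20 * (\<epsilon> * \<kappa>)) * vnorm x) + 10 * (\<epsilon> * \<kappa>) * vnorm x"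
    by (intro add_right_mono mult_left_mono Suc) simp
  also have "\<dots> = ((1 / 2) ^ Suc i + 20 * (\<epsilon> * \<kappa>)) * vnorm x"
    by (simp add: algebra_simps)
  finally show ?case .
qed

lemma half_power_ceiling_log:
  assumes "t = nat \<lceil>log 2 (1 / (\<kappa> * u))\<rceil>"
  shows "(1 / 2) ^ t \<le> \<kappa> * u"
proof -
  have pos: "0 < \<kappa> * u" using kappa_ge_1 u_pos by simp
  have "log 2 (1 / (\<kappa> * u)) \<le> real t" unfolding assms by linarith
  then have "1 / (\<kappa> * u) \<le> 2 powr real t"
    using pos by (subst (asm) log_le_iff) auto
  then have "1 / (\<kappa> * u) \<le> 2 ^ t" by (simp add: powr_realpow)
  then show ?thesis using pos by (simp add: power_divide field_simps)
qed

lemma fl_refine_final: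
  assumes bc: "b \<in> carrier_vec n" and b: "rep_vec M n b" and K: "40 \<le> real K * rate"
    and t: "t = nat \<lceil>log 2 (1 / (\<kappa> * u))\<rceil>"
  shows "measure_pmf.expectation (fl_refine M A lam \<mu> \<nu> K b t) (\<lambda>xt. vnorm (xt - inv_mat A *\<^sub>v b))
    \<le> (1 + 20 * real n) * (vnorm (inv_mat A *\<^sub>v b) * \<kappa> * u)"
proof -
  define x where "x = inv_mat A *\<^sub>v b"
  have x: "x \<in> carrier_vec n" and Ax: "A *\<^sub>v x = b" using bc by (simp_all add: x_def A_inv_vec)
  have "measure_pmf.expectation (fl_refine M A lam \<mu> \<nu> K b t) (\<lambda>xt. vnorm (xt - x))
      \<le> ((1 / 2) ^ t + 20 * (\<epsilon> * \<kappa>)) * vnorm x"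
    using fl_refine_err[OF x _ K, of t] b by (simp add: Ax)
  also have "\<dots> \<le> (\<kappa> * u + 20 * (\<epsilon> * \<kappa>)) * vnorm x"
    using half_power_ceiling_log[OF t] by (intro mult_right_mono) auto
  also have "\<dots> = (1 + 20 * real n) * (vnorm x * \<kappa> * u)"
    by (simp add: \<epsilon>_def algebra_simps)
  finally show ?thesis by (simp add: x_def)
qed

end

text \<open>The number of iterations is fixed by \<open>\<kappa>\<close> and \<open>n\<close> before the right-hand side and the arithmetic are
  known. Rounding up costs the step from 160 to 161, as \<open>\<kappa> sqrt n\<close> is at least one.\<close>

lemma (in ark_system) enough_iterations:
  assumes "K = nat \<lceil>160 * (\<kappa> * sqrt (real n))\<rceil>"
  shows "real K \<le> 161 * (\<kappa> * sqrt (real n))" and "40 \<le> real K * rate"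
proof -
  define Z where "Z = \<kappa> * sqrt (real n)"
  have "1 * 1 \<le> \<kappa> * sqrt (real n)"
    using kappa_ge_1 dim_pos by (intro mult_mono) auto
  then have Z: "1 \<le> Z" by (simp add: Z_def)
  have K: "160 * Z \<le> real K" "real K \<le> 160 * Z + 1"
    unfolding assms Z_def[symmetric] using Z by linarith+
  show "real K \<le> 161 * (\<kappa> * sqrt (real n))"
    using K(2) Z unfolding Z_def[symmetric] by linarith
  have "1 \<le> 4 * (Z * rate)" using rate_ge by (simp add: Z_def mult.assoc)
  moreover have "160 * Z * rate \<le> real K * rate" using K(1) rate_pos by (intro mult_right_mono) auto
  ultimately show "40 \<le> real K * rate" by linarith
qed

theorem theorem4p3:
  shows "\<exists>C::real. 0 < C \<and> (\<exists>P Q :: real poly.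
    (\<forall>n::nat. 1 \<le> n \<longrightarrow> 0 < poly P (real n) \<and> 0 < poly Q (real n)) \<and>
    (\<forall>(n::nat) (A::real mat) (lam::real).
       1 \<le> n \<longrightarrow> A \<in> carrier_mat n n \<longrightarrow> invertible_mat A \<longrightarrow>
       lam = (frob_norm A)\<^sup>2 / real n \<or> (lam = 0 \<and> max_row_sq A \<le> 4 * min_row_sq A) \<longrightarrow>
       (\<exists>K::nat. real K \<le> C * (demmel_cond A * sqrt (real n)) \<and>
         (\<forall>(b::real vec) (u::real) (M::fp_arith).
            b \<in> carrier_vec n \<longrightarrow>
            standard_model M u \<longrightarrow>
            data_representable M A b \<longrightarrow>
            params_representable M lam (ark_mu A lam) (ark_nu A lam) \<longrightarrow>
            (demmel_cond A)\<^sup>2 * u \<le> 1 / poly P (real n) \<longrightarrow>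
            (let x = inv_mat A *\<^sub>v b;
                 t = nat \<lceil>log 2 (1 / (demmel_cond A * u))\<rceil>
             in measure_pmf.expectation
                  (fl_refine M A lam (ark_mu A lam) (ark_nu A lam) K b t)
                  (\<lambda>xt. vnorm (xt - x))
                \<le> poly Q (real n) * (vnorm x * demmel_cond A * u))))))"
proof (rule exI[of _ 161], rule conjI, simp, rule exI[of _ "[:0, 0, 1000000:]"],
    rule exI[of _ "[:1, 20:]"], intro conjI allI impI)
  fix n :: nat assume "1 \<le> n"
  then show "0 < poly [:0, 0, 1000000:] (real n)" "0 < poly [:1, 20:] (real n)"
    by (auto intro: add_pos_nonneg)
next
  fix n :: nat and A :: "real mat" and lam :: real
  assume "1 \<le> n" "A \<in> carrier_mat n n" "invertible_mat A"
    "lam = (frob_norm A)\<^sup>2 / real n \<or> (lam = 0 \<and> max_row_sq A \<le> 4 * min_row_sq A)"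
  then interpret ark_system n A lam by unfold_locales
  define K where "K = nat \<lceil>160 * (demmel_cond A * sqrt (real n))\<rceil>"
  note K = enough_iterations[OF K_def]
  show "\<exists>K::nat. real K \<le> 161 * (demmel_cond A * sqrt (real n)) \<and>
         (\<forall>(b::real vec) (u::real) (M::fp_arith).
            b \<in> carrier_vec n \<longrightarrow>
            standard_model M u \<longrightarrow>
            data_representable M A b \<longrightarrow>
            params_representable M lam (ark_mu A lam) (ark_nu A lam) \<longrightarrow>
            (demmel_cond A)\<^sup>2 * u \<le> 1 / poly [:0, 0, 1000000:] (real n) \<longrightarrow>
            (let x = inv_mat A *\<^sub>v b;
                 t = nat \<lceil>log 2 (1 / (demmel_cond A * u))\<rceil>
             in measure_pmf.expectation
                  (fl_refine M A lam (ark_mu A lam) (ark_nu A lam) K b t)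
                  (\<lambda>xt. vnorm (xt - x))
                \<le> poly [:1, 20:] (real n) * (vnorm x * demmel_cond A * u)))"
  proof (rule exI[of _ K], intro conjI allI impI K(1))
    fix b :: "real vec" and u :: real and M :: fp_arith
    assume b: "b \<in> carrier_vec n" and model: "standard_model M u"
      and data: "data_representable M A b"
      and params: "params_representable M lam (ark_mu A lam) (ark_nu A lam)"
      and small: "(demmel_cond A)\<^sup>2 * u \<le> 1 / poly [:0, 0, 1000000:] (real n)"
    interpret fp_ark n A lam M u
      by unfold_locales (use model data params small in
          \<open>auto simp: data_representable_def power2_eq_square mult_ac\<close>)
    have "rep_vec M n b" using b data by (auto simp: rep_vec_def data_representable_def)
    from fl_refine_final[OF b this K(2) refl]
    show "let x = inv_mat A *\<^sub>v b;
                 t = nat \<lceil>log 2 (1 / (demmel_cond A * u))\<rceil>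
             in measure_pmf.expectation
                  (fl_refine M A lam (ark_mu A lam) (ark_nu A lam) K b t)
                  (\<lambda>xt. vnorm (xt - x))
                \<le> poly [:1, 20:] (real n) * (vnorm x * demmel_cond A * u)"
      by (simp add: Let_def mult.commute[of "real n"])
  qed
qed

end
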